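(* For each non-degenerate complex $n\times n$-matrix $Q$, there exists a simple $\mathfrak{gl}_{2n}$-module $M$ with the following properties: (1) $M$ has Gelfand–Kirillov dimension $n^2$; (2) $\mathrm{Res}_{\mathcal{A}}^{\mathfrak{gl}_{2n}}M$ is isomorphic to the left regular $U(\mathcal{A})$-module; (3) $\mathrm{Res}_{\mathcal{B}}^{\mathfrak{gl}_{2n}}M$ is locally finite; in other words, $M$ is a generalized Whittaker module for the Whittaker pair $(\mathcal{B},\mathfrak{gl}_{2n})$; (4) with respect to a fixed PBW basis in $U(\mathcal{A})$, the action of each fixed element from $\mathcal{A}$, $\mathcal{B}$, $\mathcal{C}$, $\mathcal{D}$ can be written explicitly as maps $U(\mathcal{A})\to U(\mathcal{A})$ of degrees $1$, $0$, $2$, $1$, respectively. Moreover, different matrices $Q$ give non-isomorphic modules.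
   Context: Everything is over $\mathbb{C}$. Write elements of $\mathfrak{gl}_{2n}=\mathfrak{gl}_{2n}(\mathbb{C})$ as block matrices with $n\times n$ blocks, and let $\mathcal{A},\mathcal{B},\mathcal{C},\mathcal{D}$ be the Lie subalgebras (each of dimension $n^2$) of matrices supported in the top-left, top-right, bottom-left and bottom-right block, respectively. $U(\cdot)$ denotes the universal enveloping algebra, and $\mathrm{Res}$ denotes restriction of a module to a subalgebra. The left regular $U(\mathcal{A})$-module is $U(\mathcal{A})$ acting on itself by left multiplication. The pair $(\mathcal{B},\mathfrak{gl}_{2n})$ is a Whittaker pair, meaning that $\mathcal{B}$ is nilpotent (here even commutative) and its adjoint action on $\mathfrak{gl}_{2n}/\mathcal{B}$ is nilpotent; a generalized Whittaker module for this pair is a $\mathfrak{gl}_{2n}$-module on which the action of $\mathcal{B}$ is locally finite, i.e. $\dim U(\mathcal{B})m<\infty$ for every $m$ in the module. In (4), $M$ is identified with $U(\mathcal{A})$ as in (2), and degrees of maps refer to the filtration of $U(\mathcal{A})$ by total degree of PBW monomials. *)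

theory Defs
  imports "HOL-Analysis.Analysis" "HOL-Library.Poly_Mapping"
begin

section \<open>Matrix Lie algebras and the four blocks\<close>

definition mscale :: "complex \<Rightarrow> complex^'m^'m \<Rightarrow> complex^'m^'m" where
  "mscale c X = (\<chi> i j. c * X $ i $ j)"

definition lie_bracket :: "complex^'m^'m \<Rightarrow> complex^'m^'m \<Rightarrow> complex^'m^'m::finite" where
  "lie_bracket X Y = X ** Y - Y ** X"

definition lie_subalgebra :: "(complex^'m^'m::finite) set \<Rightarrow> bool" where
  "lie_subalgebra L \<longleftrightarrow> module.subspace mscale L \<and> (\<forall>X\<in>L. \<forall>Y\<in>L. lie_bracket X Y \<in> L)"

text \<open>The index type \<open>'n + 'n\<close> has \<open>2n\<close> elements for \<open>n = CARD('n)\<close>; the constructors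
  \<open>Inl\<close> and \<open>Inr\<close> index the first and the second half of the rows and columns.\<close>

type_synonym 'n gl2 = "complex^('n + 'n)^('n + 'n)"

definition supported_in :: "'m set \<Rightarrow> 'm set \<Rightarrow> (complex^'m^'m) set" where
  "supported_in R C = {X. \<forall>i j. X $ i $ j \<noteq> 0 \<longrightarrow> i \<in> R \<and> j \<in> C}"

definition blockA :: "('n::finite) gl2 set" where
  "blockA = supported_in (range Inl) (range Inl)"

definition blockB :: "('n::finite) gl2 set" where
  "blockB = supported_in (range Inl) (range Inr)"

definition blockC :: "('n::finite) gl2 set" where
  "blockC = supported_in (range Inr) (range Inl)"

definition blockD :: "('n::finite) gl2 set" where
  "blockD = supported_in (range Inr) (range Inr)"


section \<open>Universal enveloping algebras\<close>

text \<open>Lists form the free monoid under concatenation, so that \<open>'a list \<Rightarrow>\<^sub>0 complex\<close> with the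
  convolution product of \<open>Poly_Mapping\<close> is the free unital associative algebra on \<open>'a\<close>.\<close>

instantiation list :: (type) monoid_add
begin
definition zero_list :: "'a list" where "zero_list = []"
definition plus_list :: "'a list \<Rightarrow> 'a list \<Rightarrow> 'a list" where "plus_list = (@)"
instance by standard (simp_all add: zero_list_def plus_list_def)
end

definition free_gen :: "'a \<Rightarrow> ('a list \<Rightarrow>\<^sub>0 complex)" where
  "free_gen x = Poly_Mapping.single [x] 1"

definition free_const :: "complex \<Rightarrow> ('a list \<Rightarrow>\<^sub>0 complex)" where
  "free_const c = Poly_Mapping.single [] c"

definition free_on :: "'a set \<Rightarrow> ('a list \<Rightarrow>\<^sub>0 complex) set" where
  "free_on L = {p. \<forall>w \<in> Poly_Mapping.keys p. set w \<subseteq> L}"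

text \<open>For a Lie subalgebra \<open>L\<close>, the enveloping algebra \<open>U(L)\<close> is the free algebra on the set
  \<open>L\<close> modulo the relations below: the first two families turn it into the tensor algebra of the
  vector space \<open>L\<close>, the third one identifies commutators with Lie brackets.\<close>

definition uea_relators :: "(complex^'m^'m::finite) set \<Rightarrow> ((complex^'m^'m) list \<Rightarrow>\<^sub>0 complex) set" where
  "uea_relators L =
     {free_gen (X + Y) - free_gen X - free_gen Y | X Y. X \<in> L \<and> Y \<in> L}
   \<union> {free_gen (mscale c X) - free_const c * free_gen X | c X. X \<in> L}
   \<union> {free_gen X * free_gen Y - free_gen Y * free_gen X - free_gen (lie_bracket X Y) | X Y.
        X \<in> L \<and> Y \<in> L}"

inductive_set uea_ideal :: "(complex^'m^'m::finite) set \<Rightarrow> ((complex^'m^'m) list \<Rightarrow>\<^sub>0 complex) set"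
  for L :: "(complex^'m^'m) set" where
  zero: "0 \<in> uea_ideal L"
| step: "\<lbrakk>u \<in> uea_ideal L; r \<in> uea_relators L; p \<in> free_on L; q \<in> free_on L\<rbrakk>
         \<Longrightarrow> u + p * r * q \<in> uea_ideal L"

definition uea_eq :: "(complex^'m^'m::finite) set
    \<Rightarrow> ((complex^'m^'m) list \<Rightarrow>\<^sub>0 complex) \<Rightarrow> ((complex^'m^'m) list \<Rightarrow>\<^sub>0 complex) \<Rightarrow> bool" where
  "uea_eq L p q \<longleftrightarrow> p \<in> free_on L \<and> q \<in> free_on L \<and> p - q \<in> uea_ideal L"

lemma free_on_0 [simp]: "0 \<in> free_on L"
  by (simp add: free_on_def)

lemma free_on_const [simp]: "free_const c \<in> free_on L"
  by (auto simp: free_on_def free_const_def)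

lemma free_on_1 [simp]: "1 \<in> free_on L"
  by (auto simp: free_on_def zero_list_def simp flip: single_one)

lemma free_on_gen [simp]: "free_gen x \<in> free_on L \<longleftrightarrow> x \<in> L"
  by (auto simp: free_on_def free_gen_def)

lemma free_on_add: "p \<in> free_on L \<Longrightarrow> q \<in> free_on L \<Longrightarrow> p + q \<in> free_on L"
  unfolding free_on_def using keys_add[of p q] by blast

lemma free_on_uminus: "p \<in> free_on L \<Longrightarrow> - p \<in> free_on L"
  by (simp add: free_on_def)

lemma free_on_diff: "p \<in> free_on L \<Longrightarrow> q \<in> free_on L \<Longrightarrow> p - q \<in> free_on L"
  using free_on_add[of p L "- q"] free_on_uminus[of q L] by simp

lemma free_on_mult:
  assumes "p \<in> free_on L" "q \<in> free_on L"
  shows "p * q \<in> free_on L"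
proof -
  have "set w \<subseteq> L" if "w \<in> Poly_Mapping.keys (p * q)" for w
  proof -
    have "w \<in> {a + b | a b. a \<in> Poly_Mapping.keys p \<and> b \<in> Poly_Mapping.keys q}"
      using keys_mult[of p q] that by blast
    then show ?thesis
      using assms by (fastforce simp: free_on_def plus_list_def)
  qed
  then show ?thesis
    by (simp add: free_on_def)
qed

lemma uea_ideal_add:
  assumes "u \<in> uea_ideal L" "v \<in> uea_ideal L"
  shows "u + v \<in> uea_ideal L"
  using assms(2)
proof induction
  case zero
  then show ?case using assms(1) by simp
next
  case (step v r p q)
  then show ?case
    using uea_ideal.step[of "u + v" L r p q] by (simp add: add.assoc)
qed

lemma uea_ideal_mult_left:
  assumes "u \<in> uea_ideal L" "a \<in> free_on L"
  shows "a * u \<in> uea_ideal L"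
  using assms(1)
proof induction
  case zero
  then show ?case by (simp add: uea_ideal.zero)
next
  case (step u r p q)
  then show ?case
    using uea_ideal.step[of "a * u" L r "a * p" q] free_on_mult[OF assms(2)]
    by (simp add: algebra_simps)
qed

lemma uea_ideal_mult_right:
  assumes "u \<in> uea_ideal L" "a \<in> free_on L"
  shows "u * a \<in> uea_ideal L"
  using assms(1)
proof induction
  case zero
  then show ?case by (simp add: uea_ideal.zero)
next
  case (step u r p q)
  then show ?case
    using uea_ideal.step[of "u * a" L r p "q * a"] free_on_mult[OF _ assms(2)]
    by (simp add: algebra_simps)
qed

lemma uea_ideal_uminus: "u \<in> uea_ideal L \<Longrightarrow> - u \<in> uea_ideal L"
  using uea_ideal_mult_left[of u L "- 1"] free_on_uminus[of 1 L] by simp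

lemma part_equivp_uea_eq: "part_equivp (uea_eq L)"
proof (rule part_equivpI)
  show "\<exists>p. uea_eq L p p"
    by (rule exI[of _ 0]) (simp add: uea_eq_def uea_ideal.zero)
  show "symp (uea_eq L)"
    by (rule sympI) (auto simp: uea_eq_def dest: uea_ideal_uminus)
  show "transp (uea_eq L)"
  proof (rule transpI)
    fix p q r assume "uea_eq L p q" "uea_eq L q r"
    then show "uea_eq L p r"
      using uea_ideal_add[of "p - q" L "q - r"] by (simp add: uea_eq_def)
  qed
qed

text \<open>The type \<open>'n UA\<close> is \<open>U(\<A>)\<close>.\<close>

quotient_type 'n UA = "('n::finite) gl2 list \<Rightarrow>\<^sub>0 complex" / partial: "uea_eq (blockA :: 'n gl2 set)"
  by (rule part_equivp_uea_eq)

lemma free_lookup_Nil_mult: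
  fixes p q :: "'a list \<Rightarrow>\<^sub>0 complex"
  shows "Poly_Mapping.lookup (p * q) [] = Poly_Mapping.lookup p [] * Poly_Mapping.lookup q []"
proof -
  have "Sum_any (\<lambda>b. Poly_Mapping.lookup q b when [] = a + b)
      = (Poly_Mapping.lookup q [] when a = [])" for a
    by (cases "a = []") (simp_all add: plus_list_def)
  then have "Poly_Mapping.lookup (p * q) []
      = Sum_any (\<lambda>a. Poly_Mapping.lookup p a * Poly_Mapping.lookup q [] when a = [])"
    by (simp only: lookup_mult mult_when)
  then show ?thesis
    by simp
qed

lemma uea_ideal_lookup_Nil: "u \<in> uea_ideal L \<Longrightarrow> Poly_Mapping.lookup u [] = 0"
proof (induction rule: uea_ideal.induct)
  case (step u r p q)
  have "Poly_Mapping.lookup r [] = 0"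
    using step.hyps(2)
    by (auto simp: uea_relators_def lookup_minus free_lookup_Nil_mult free_gen_def
        lookup_single_not_eq)
  with step.IH show ?case
    by (simp add: lookup_add free_lookup_Nil_mult)
qed simp

instantiation UA :: (finite) ring_1
begin

lift_definition zero_UA :: "'a UA" is 0
  by (simp add: uea_eq_def uea_ideal.zero)

lift_definition one_UA :: "'a UA" is 1
  by (simp add: uea_eq_def uea_ideal.zero)

lift_definition plus_UA :: "'a UA \<Rightarrow> 'a UA \<Rightarrow> 'a UA" is "(+)"
proof -
  fix p p' q q' :: "'a gl2 list \<Rightarrow>\<^sub>0 complex"
  assume "uea_eq blockA p p'" "uea_eq blockA q q'"
  then show "uea_eq blockA (p + q) (p' + q')"
    using uea_ideal_add[of "p - p'" blockA "q - q'"]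
    by (simp add: uea_eq_def free_on_add algebra_simps)
qed

lift_definition uminus_UA :: "'a UA \<Rightarrow> 'a UA" is uminus
proof -
  fix p q :: "'a gl2 list \<Rightarrow>\<^sub>0 complex"
  assume "uea_eq blockA p q"
  then show "uea_eq blockA (- p) (- q)"
    using uea_ideal_uminus[of "p - q" blockA] by (simp add: uea_eq_def free_on_uminus)
qed

lift_definition minus_UA :: "'a UA \<Rightarrow> 'a UA \<Rightarrow> 'a UA" is "(-)"
proof -
  fix p p' q q' :: "'a gl2 list \<Rightarrow>\<^sub>0 complex"
  assume "uea_eq blockA p p'" "uea_eq blockA q q'"
  then show "uea_eq blockA (p - q) (p' - q')"
    using uea_ideal_add[of "p - p'" blockA "- (q - q')"] uea_ideal_uminus[of "q - q'" blockA]
    by (simp add: uea_eq_def free_on_diff algebra_simps)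
qed

lift_definition times_UA :: "'a UA \<Rightarrow> 'a UA \<Rightarrow> 'a UA" is "(*)"
proof -
  fix p p' q q' :: "'a gl2 list \<Rightarrow>\<^sub>0 complex"
  assume *: "uea_eq blockA p p'" "uea_eq blockA q q'"
  have "p * q - p' * q' = (p - p') * q + p' * (q - q')"
    by (simp add: algebra_simps)
  then show "uea_eq blockA (p * q) (p' * q')"
    using * uea_ideal_add uea_ideal_mult_left uea_ideal_mult_right
    by (metis free_on_mult uea_eq_def)
qed

instance
proof
  show "(0 :: 'a UA) \<noteq> 1"
    by transfer (auto simp: uea_eq_def zero_list_def lookup_one lookup_minus
        dest!: uea_ideal_lookup_Nil)
qed (transfer; simp add: uea_eq_def algebra_simps uea_ideal.zero
      free_on_add free_on_mult free_on_uminus free_on_diff)+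

end

lift_definition UA_scale :: "complex \<Rightarrow> ('n::finite) UA \<Rightarrow> 'n UA" is "\<lambda>c p. free_const c * p"
proof -
  fix c and p q :: "'n gl2 list \<Rightarrow>\<^sub>0 complex"
  assume "uea_eq blockA p q"
  then show "uea_eq blockA (free_const c * p) (free_const c * q)"
    using uea_ideal_mult_left[of "p - q" blockA "free_const c"]
    by (simp add: uea_eq_def free_on_mult right_diff_distrib)
qed

text \<open>The canonical map \<open>\<A> \<rightarrow> U(\<A>)\<close>; its values outside \<open>blockA\<close> are meaningless.\<close>

definition UA_incl :: "('n::finite) gl2 \<Rightarrow> 'n UA" where
  "UA_incl X = abs_UA (free_gen X)"

definition ordered_basis :: "(complex^'m^'m) set \<Rightarrow> (complex^'m^'m) list \<Rightarrow> bool" where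
  "ordered_basis L bs \<longleftrightarrow>
     distinct bs \<and> \<not> module.dependent mscale (set bs) \<and> module.span mscale (set bs) = L"

definition PBW_monomial :: "('n::finite) gl2 list \<Rightarrow> nat list \<Rightarrow> 'n UA" where
  "PBW_monomial bs es = prod_list (map2 (\<lambda>X e. UA_incl X ^ e) bs es)"

definition PBW_filtration :: "('n::finite) gl2 list \<Rightarrow> nat \<Rightarrow> 'n UA set" where
  "PBW_filtration bs k =
     module.span UA_scale {PBW_monomial bs es | es. length es = length bs \<and> sum_list es \<le> k}"

text \<open>As usual for maps of filtered spaces, degree \<open>d\<close> means that the filtration degree is raised
  by at most \<open>d\<close>.\<close>

definition map_of_degree :: "(nat \<Rightarrow> 'v set) \<Rightarrow> nat \<Rightarrow> ('v \<Rightarrow> 'v) \<Rightarrow> bool" where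
  "map_of_degree F d f \<longleftrightarrow> (\<forall>k. f ` F k \<subseteq> F (k + d))"


section \<open>Modules\<close>

text \<open>A module consists of a scalar multiplication \<open>s\<close> on the abelian group \<open>'v\<close> and an
  action \<open>\<rho>\<close> of the Lie algebra of all matrices on it.\<close>

definition gl_module ::
    "(complex \<Rightarrow> 'v::ab_group_add \<Rightarrow> 'v) \<Rightarrow> (complex^'m^'m::finite \<Rightarrow> 'v \<Rightarrow> 'v) \<Rightarrow> bool" where
  "gl_module s \<rho> \<longleftrightarrow>
     (\<forall>X. Vector_Spaces.linear s s (\<rho> X)) \<and>
     (\<forall>v. Vector_Spaces.linear mscale s (\<lambda>X. \<rho> X v)) \<and>
     (\<forall>X Y v. \<rho> (lie_bracket X Y) v = \<rho> X (\<rho> Y v) - \<rho> Y (\<rho> X v))"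

definition simple_gl_module ::
    "(complex \<Rightarrow> 'v::ab_group_add \<Rightarrow> 'v) \<Rightarrow> (complex^'m^'m::finite \<Rightarrow> 'v \<Rightarrow> 'v) \<Rightarrow> bool" where
  "simple_gl_module s \<rho> \<longleftrightarrow>
     gl_module s \<rho> \<and> (\<exists>v::'v. v \<noteq> 0) \<and>
     (\<forall>W. module.subspace s W \<and> (\<forall>X. \<rho> X ` W \<subseteq> W) \<longrightarrow> W = {0} \<or> W = UNIV)"

definition module_iso_over :: "(complex^'m^'m::finite) set
    \<Rightarrow> (complex \<Rightarrow> 'v::ab_group_add \<Rightarrow> 'v) \<Rightarrow> (complex^'m^'m \<Rightarrow> 'v \<Rightarrow> 'v)
    \<Rightarrow> (complex \<Rightarrow> 'w::ab_group_add \<Rightarrow> 'w) \<Rightarrow> (complex^'m^'m \<Rightarrow> 'w \<Rightarrow> 'w)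
    \<Rightarrow> ('v \<Rightarrow> 'w) \<Rightarrow> bool" where
  "module_iso_over L s \<rho> s' \<rho>' f \<longleftrightarrow>
     Vector_Spaces.linear s s' f \<and> bij f \<and> (\<forall>X\<in>L. \<forall>v. f (\<rho> X v) = \<rho>' X (f v))"

definition left_regular :: "('n::finite) gl2 \<Rightarrow> 'n UA \<Rightarrow> 'n UA" where
  "left_regular X u = UA_incl X * u"

text \<open>\<open>U(L)\<close> and its subspace \<open>U(L)\<^sub>\<le>\<^sub>k\<close> are spanned by the products of elements of \<open>L\<close>,
  respectively of at most \<open>k\<close> elements. Hence the next two definitions are
  \<open>U(L)S\<close> and \<open>U(L)\<^sub>\<le>\<^sub>k S\<close> for a subset \<open>S\<close> of the module.\<close>

definition U_orbit :: "(complex \<Rightarrow> 'v::ab_group_add \<Rightarrow> 'v) \<Rightarrow> (complex^'m^'m \<Rightarrow> 'v \<Rightarrow> 'v)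
    \<Rightarrow> (complex^'m^'m) set \<Rightarrow> 'v set \<Rightarrow> 'v set" where
  "U_orbit s \<rho> L S = module.span s {foldr \<rho> Xs v | Xs v. set Xs \<subseteq> L \<and> v \<in> S}"

definition U_orbit_upto :: "(complex \<Rightarrow> 'v::ab_group_add \<Rightarrow> 'v) \<Rightarrow> (complex^'m^'m \<Rightarrow> 'v \<Rightarrow> 'v)
    \<Rightarrow> (complex^'m^'m) set \<Rightarrow> nat \<Rightarrow> 'v set \<Rightarrow> 'v set" where
  "U_orbit_upto s \<rho> L k S =
     module.span s {foldr \<rho> Xs v | Xs v. set Xs \<subseteq> L \<and> length Xs \<le> k \<and> v \<in> S}"

text \<open>The supremum runs over the finite-dimensional subspaces \<open>V\<close> of the module, given by
  finite spanning sets \<open>S\<close>; \<open>\<complex> \<oplus> \<gg>\<ll>\<close> serves as the finite-dimensional generating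
  subspace of the enveloping algebra. For finitely generated modules the supremum is attained at any
  generating \<open>V\<close>.\<close>

definition GK_dimension ::
    "(complex \<Rightarrow> 'v::ab_group_add \<Rightarrow> 'v) \<Rightarrow> (complex^'m^'m \<Rightarrow> 'v \<Rightarrow> 'v) \<Rightarrow> ereal" where
  "GK_dimension s \<rho> =
     (SUP S \<in> {S. finite S}.
        limsup (\<lambda>k. ereal (log (real k) (real (vector_space.dim s (U_orbit_upto s \<rho> UNIV k S))))))"

definition locally_finite_over :: "(complex^'m^'m) set
    \<Rightarrow> (complex \<Rightarrow> 'v::ab_group_add \<Rightarrow> 'v) \<Rightarrow> (complex^'m^'m \<Rightarrow> 'v \<Rightarrow> 'v) \<Rightarrow> bool" where
  "locally_finite_over L s \<rho> \<longleftrightarrow>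
     (\<forall>v. \<exists>T. finite T \<and> U_orbit s \<rho> L {v} \<subseteq> module.span s T)"

text \<open>The last two conjuncts say that \<open>N\<close> is nilpotent and that \<open>N\<close> acts nilpotently on
  \<open>\<gg>\<ll>/N\<close>.\<close>

definition whittaker_pair :: "(complex^'m^'m::finite) set \<Rightarrow> bool" where
  "whittaker_pair N \<longleftrightarrow>
     lie_subalgebra N \<and>
     (\<exists>k. \<forall>Xs. length Xs = k \<and> set Xs \<subseteq> N \<longrightarrow> (\<forall>Y\<in>N. foldr lie_bracket Xs Y = 0)) \<and>
     (\<exists>k. \<forall>Xs. length Xs = k \<and> set Xs \<subseteq> N \<longrightarrow> (\<forall>Y. foldr lie_bracket Xs Y \<in> N))"

definition generalized_whittaker_module :: "(complex^'m^'m::finite) set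
    \<Rightarrow> (complex \<Rightarrow> 'v::ab_group_add \<Rightarrow> 'v) \<Rightarrow> (complex^'m^'m \<Rightarrow> 'v \<Rightarrow> 'v) \<Rightarrow> bool" where
  "generalized_whittaker_module N s \<rho> \<longleftrightarrow>
     whittaker_pair N \<and> gl_module s \<rho> \<and> locally_finite_over N s \<rho>"

end

theory Submission
  imports Defs "HOL-Library.Function_Algebras" "HOL-Real_Asymp.Real_Asymp"
begin

text \<open>The module is \<open>U(\<A>)\<close> itself, with \<open>\<A>\<close> acting by left multiplication. A picture of it: the
  polynomials in an \<open>n \<times> n\<close> matrix \<open>x\<close>, multiplied by \<open>exp (trace (Q x))\<close>, where the vector fields
  of the Grassmannian make \<open>\<B>\<close> act by translations, \<open>\<A>\<close> and \<open>\<D>\<close> by linear and \<open>\<C>\<close> by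
  quadratic vector fields. As \<open>Q\<close> is invertible, \<open>\<A>\<close> then produces all linear functions from the
  generator, so that this space is free of rank one over \<open>U(\<A>)\<close>. The proof is carried out in
  \<open>U(\<A>)\<close>.

  Construction. An operator family \<open>\<rho>\<close> extending left multiplication and compatible with it,
  \<open>\<rho> X (a u) = a (\<rho> X u) + \<rho> [X, a] u\<close>, is the same as a linear map \<open>\<theta> X = \<rho> X 1\<close>
  (\<open>left_regular_extension\<close>, from the universal property of \<open>U(\<A>)\<close>). Here \<open>\<theta>\<close> is chosen such
  that \<open>\<B>\<close> acts on \<open>1\<close> by the character \<open>b \<mapsto> trace (Q b)\<close>.

  The main tools are the operators \<open>lower b = trace (Q b) - \<rho> b\<close> for \<open>b\<close> in \<open>\<B>\<close>. They lower the degree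
  by one and act on the associated graded polynomial algebra as directional derivatives. Hence Euler's
  identity holds up to terms of smaller degree (\<open>euler_lower\<close>), and only the scalars are
  annihilated by all of them (\<open>lower_eq_0_imp_scalar\<close>). Everything else follows from that.

  Relations. The failure of \<open>\<rho>\<close> to respect the bracket of \<open>X\<close> and \<open>Y\<close> need only be examined at
  \<open>1\<close> (\<open>rel_eq_0_if_at_one\<close>). If \<open>X\<close> is in \<open>\<B>\<close>, this is a computation with at most two
  generators (\<open>lower_\<theta>\<close>). For \<open>X\<close> and \<open>Y\<close> in \<open>\<C>\<close> or \<open>\<D>\<close> the value at \<open>1\<close> is annihilated
  by the lowering operators, hence a scalar, and it lies in the augmentation ideal, so it is zero
  (\<open>rel_CD_one\<close>).

  Properties. In a nonzero submodule, an element of least degree is annihilated by the lowering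
  operators, so it is a scalar, and it generates everything. A common eigenvector of \<open>\<B>\<close> can only have
  the character \<open>b \<mapsto> trace (Q b)\<close>, which distinguishes the matrices \<open>Q\<close>. Differentiating monomials
  shows that they are linearly independent, and counting them gives the Gelfand-Kirillov
  dimension. The degrees of the operators can be read off from \<open>\<theta>\<close>.\<close>

section \<open>Block matrices\<close>

lemma vector_space_mscale: "vector_space mscale"
  by standard (simp_all add: mscale_def vec_eq_iff algebra_simps)

interpretation mat_vs: vector_space mscale
  by (rule vector_space_mscale)

lemma mscale_nth [simp]: "mscale c X $ i $ j = c * X $ i $ j"
  by (simp add: mscale_def)

lemma mscale_mult_left: "mscale c X ** Y = mscale c (X ** Y)"
  by (simp add: vec_eq_iff matrix_matrix_mult_def sum_distrib_left mult.assoc)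

lemma mscale_mult_right: "X ** mscale c Y = mscale c (X ** Y)"
  by (simp add: vec_eq_iff matrix_matrix_mult_def sum_distrib_left algebra_simps)

lemma matrix_add_rdistrib: "((A :: complex^'n^'m) + B) ** C = A ** C + B ** C"
  by (simp add: vec_eq_iff matrix_matrix_mult_def sum.distrib algebra_simps)

lemma matrix_diff_ldistrib: "(A :: complex^'n^'m) ** (B - C) = A ** B - A ** C"
  by (simp add: vec_eq_iff matrix_matrix_mult_def sum_subtractf algebra_simps)

lemma matrix_diff_rdistrib: "((A :: complex^'n^'m) - B) ** C = A ** C - B ** C"
  by (simp add: vec_eq_iff matrix_matrix_mult_def sum_subtractf algebra_simps)

lemma matrix_uminus_left: "(- (A :: complex^'n^'m)) ** B = - (A ** B)"
  by (simp add: vec_eq_iff matrix_matrix_mult_def sum_negf)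

lemma matrix_uminus_right: "(A :: complex^'n^'m) ** (- B) = - (A ** B)"
  by (simp add: vec_eq_iff matrix_matrix_mult_def sum_negf)

lemma matrix_mult_0_left [simp]: "(0 :: complex^'n^'m) ** B = 0"
  by (simp add: vec_eq_iff matrix_matrix_mult_def)

lemma matrix_mult_0_right [simp]: "(B :: complex^'n^'m) ** 0 = 0"
  by (simp add: vec_eq_iff matrix_matrix_mult_def)

lemmas matrix_ring = matrix_add_ldistrib matrix_add_rdistrib matrix_diff_ldistrib
  matrix_diff_rdistrib matrix_uminus_left matrix_uminus_right matrix_mul_assoc

lemma trace_mscale: "trace (mscale c X) = c * trace X"
  by (simp add: trace_def sum_distrib_left)

lemma trace_zero [simp]: "trace (0 :: complex^'n^'n) = 0"
  by (simp add: trace_def)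

lemma lie_bracket_jacobi:
  "lie_bracket X (lie_bracket Y Z) = lie_bracket (lie_bracket X Y) Z + lie_bracket Y (lie_bracket X Z)"
  by (simp add: lie_bracket_def matrix_ring)

lemma lie_bracket_add_left: "lie_bracket (X + Y) Z = lie_bracket X Z + lie_bracket Y Z"
  and lie_bracket_add_right: "lie_bracket Z (X + Y) = lie_bracket Z X + lie_bracket Z Y"
  and lie_bracket_mscale_left: "lie_bracket (mscale c X) Z = mscale c (lie_bracket X Z)"
  and lie_bracket_mscale_right: "lie_bracket Z (mscale c X) = mscale c (lie_bracket Z X)"
  and lie_bracket_anticomm: "lie_bracket X Y = - lie_bracket Y X"
  by (simp_all add: lie_bracket_def matrix_ring mscale_mult_left mscale_mult_right
      mat_vs.scale_right_diff_distrib)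

lemma lie_bracket_0: "lie_bracket 0 X = 0" "lie_bracket X 0 = 0"
  by (simp_all add: lie_bracket_def)

definition elem_mat :: "'n \<Rightarrow> 'n \<Rightarrow> complex^'n^'n" where
  "elem_mat i j = (\<chi> k l. if k = i \<and> l = j then 1 else 0)"

lemma elem_mat_mult_left_nth:
  "(elem_mat i j ** X) $ k $ l = (if k = i then X $ j $ l else 0)" for X :: "complex^'n^'n"
  by (simp add: matrix_matrix_mult_def elem_mat_def mult_delta_left)

lemma elem_mat_mult_right_nth:
  "(X ** elem_mat i j) $ k $ l = (if l = j then X $ k $ i else 0)" for X :: "complex^'n^'n"
  by (simp add: matrix_matrix_mult_def elem_mat_def mult_delta_right)

lemma elem_mat_mult_elem_mat:
  "elem_mat i j ** elem_mat k l = (if j = k then elem_mat i l else 0 :: complex^'n^'n)"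
  by (auto simp: vec_eq_iff elem_mat_mult_left_nth) (auto simp: elem_mat_def)

lemma trace_mult_elem_mat: "trace (X ** elem_mat i j) = X $ j $ i" for X :: "complex^'n^'n"
  by (simp add: trace_def elem_mat_mult_right_nth)

lemma mat_eq_sum_elem_mat: "X = (\<Sum>i\<in>UNIV. \<Sum>j\<in>UNIV. mscale (X $ i $ j) (elem_mat i j))"
  for X :: "complex^'n^'n"
proof -
  have "(\<Sum>i\<in>UNIV. \<Sum>j\<in>UNIV. X $ i $ j * (if k = i \<and> l = j then 1 else 0)) = X $ k $ l" for k l
  proof -
    have "(\<Sum>j\<in>UNIV. X $ i $ j * (if k = i \<and> l = j then 1 else 0)) = (if i = k then X $ k $ l else 0)" for i
    proof -
      have "(\<Sum>j\<in>UNIV. X $ i $ j * (if k = i \<and> l = j then 1 else 0))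
          = (\<Sum>j\<in>UNIV. if j = l then (if i = k then X $ k $ l else 0) else 0)"
        by (intro sum.cong) auto
      then show ?thesis by simp
    qed
    then show ?thesis by simp
  qed
  then show ?thesis
    by (simp add: vec_eq_iff elem_mat_def)
qed

definition block_mat :: "complex^'n^'n \<Rightarrow> complex^'n^'n \<Rightarrow> complex^'n^'n \<Rightarrow> complex^'n^'n \<Rightarrow> ('n::finite) gl2"
  where "block_mat a b c d = (\<chi> i j. case i of
      Inl k \<Rightarrow> (case j of Inl l \<Rightarrow> a $ k $ l | Inr l \<Rightarrow> b $ k $ l)
    | Inr k \<Rightarrow> (case j of Inl l \<Rightarrow> c $ k $ l | Inr l \<Rightarrow> d $ k $ l))"

lemma block_mat_nth [simp]:
  "block_mat a b c d $ Inl k $ Inl l = a $ k $ l"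
  "block_mat a b c d $ Inl k $ Inr l = b $ k $ l"
  "block_mat a b c d $ Inr k $ Inl l = c $ k $ l"
  "block_mat a b c d $ Inr k $ Inr l = d $ k $ l"
  by (simp_all add: block_mat_def)

lemma gl2_eq_iff:
  "X = Y \<longleftrightarrow> (\<forall>k l. X $ Inl k $ Inl l = Y $ Inl k $ Inl l \<and> X $ Inl k $ Inr l = Y $ Inl k $ Inr l
     \<and> X $ Inr k $ Inl l = Y $ Inr k $ Inl l \<and> X $ Inr k $ Inr l = Y $ Inr k $ Inr l)"
  for X Y :: "'n::finite gl2"
  by (auto simp: vec_eq_iff split_sum_all)

lemma block_mat_eq_iff [simp]:
  "block_mat a b c d = block_mat a' b' c' d' \<longleftrightarrow> a = a' \<and> b = b' \<and> c = c' \<and> d = d'"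
  by (auto simp: gl2_eq_iff) (simp_all add: vec_eq_iff)

lemma block_mat_cases: obtains a b c d where "X = block_mat a b c d"
proof
  show "X = block_mat (\<chi> k l. X $ Inl k $ Inl l) (\<chi> k l. X $ Inl k $ Inr l)
      (\<chi> k l. X $ Inr k $ Inl l) (\<chi> k l. X $ Inr k $ Inr l)"
    by (simp add: gl2_eq_iff)
qed

definition block_tl :: "('n::finite) gl2 \<Rightarrow> complex^'n^'n" where
  "block_tl X = (\<chi> k l. X $ Inl k $ Inl l)"

definition block_tr :: "('n::finite) gl2 \<Rightarrow> complex^'n^'n" where
  "block_tr X = (\<chi> k l. X $ Inl k $ Inr l)"

definition block_bl :: "('n::finite) gl2 \<Rightarrow> complex^'n^'n" where
  "block_bl X = (\<chi> k l. X $ Inr k $ Inl l)"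

definition block_br :: "('n::finite) gl2 \<Rightarrow> complex^'n^'n" where
  "block_br X = (\<chi> k l. X $ Inr k $ Inr l)"

lemma blocks_block_mat [simp]:
  "block_tl (block_mat a b c d) = a" "block_tr (block_mat a b c d) = b"
  "block_bl (block_mat a b c d) = c" "block_br (block_mat a b c d) = d"
  by (simp_all add: block_tl_def block_tr_def block_bl_def block_br_def vec_eq_iff)

lemma block_mat_add:
  "block_mat a b c d + block_mat a' b' c' d' = block_mat (a + a') (b + b') (c + c') (d + d')"
  and block_mat_diff:
  "block_mat a b c d - block_mat a' b' c' d' = block_mat (a - a') (b - b') (c - c') (d - d')"
  and block_mat_uminus: "- block_mat a b c d = block_mat (- a) (- b) (- c) (- d)"
  and block_mat_mscale:
  "mscale s (block_mat a b c d) = block_mat (mscale s a) (mscale s b) (mscale s c) (mscale s d)"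
  and block_mat_0: "block_mat 0 0 0 0 = 0"
  by (simp_all add: gl2_eq_iff)

lemma block_mat_mult:
  fixes a b c d a' b' c' d' :: "complex^'n^'n::finite"
  shows "block_mat a b c d ** block_mat a' b' c' d'
    = block_mat (a ** a' + b ** c') (a ** b' + b ** d') (c ** a' + d ** c') (c ** b' + d ** d')"
proof -
  have "(\<Sum>k\<in>UNIV. f k) = (\<Sum>k\<in>UNIV. f (Inl k)) + (\<Sum>k\<in>UNIV. f (Inr k))" for f :: "'n + 'n \<Rightarrow> complex"
    unfolding UNIV_Plus_UNIV[symmetric] by (subst sum.Plus) simp_all
  then show ?thesis
    by (simp add: gl2_eq_iff matrix_matrix_mult_def)
qed

lemma block_mat_lie_bracket: "lie_bracket (block_mat a b c d) (block_mat a' b' c' d')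
    = block_mat (lie_bracket a a' + (b ** c' - b' ** c)) (a ** b' + b ** d' - a' ** b - b' ** d)
        (c ** a' + d ** c' - c' ** a - d' ** c) (lie_bracket d d' + (c ** b' - c' ** b))"
  by (simp add: lie_bracket_def block_mat_mult block_mat_diff)

lemma blockA_eq: "(blockA :: ('n::finite) gl2 set) = range (\<lambda>a. block_mat a 0 0 0)"
  and blockB_eq: "(blockB :: ('n::finite) gl2 set) = range (\<lambda>b. block_mat 0 b 0 0)"
  and blockC_eq: "(blockC :: ('n::finite) gl2 set) = range (\<lambda>c. block_mat 0 0 c 0)"
  and blockD_eq: "(blockD :: ('n::finite) gl2 set) = range (\<lambda>d. block_mat 0 0 0 d)"
proof -
  have *: "block_mat a b c d \<in> blockA \<longleftrightarrow> b = 0 \<and> c = 0 \<and> d = 0"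
    "block_mat a b c d \<in> blockB \<longleftrightarrow> a = 0 \<and> c = 0 \<and> d = 0"
    "block_mat a b c d \<in> blockC \<longleftrightarrow> a = 0 \<and> b = 0 \<and> d = 0"
    "block_mat a b c d \<in> blockD \<longleftrightarrow> a = 0 \<and> b = 0 \<and> c = 0" for a b c d :: "complex^'n^'n"
    by (auto simp: blockA_def blockB_def blockC_def blockD_def supported_in_def split_sum_all vec_eq_iff)
  show "blockA = range (\<lambda>a. block_mat a 0 0 0 :: 'n gl2)"
    "blockB = range (\<lambda>b. block_mat 0 b 0 0 :: 'n gl2)"
    "blockC = range (\<lambda>c. block_mat 0 0 c 0 :: 'n gl2)"
    "blockD = range (\<lambda>d. block_mat 0 0 0 d :: 'n gl2)"
    by (auto simp: *, (metis * block_mat_cases rangeI)+)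
qed

text \<open>Give \<open>\<C>\<close>, \<open>\<A> \<oplus> \<D>\<close> and \<open>\<B>\<close> the degrees \<open>-1\<close>, \<open>0\<close> and \<open>1\<close>. A bracket with \<open>\<B>\<close>
  raises the degree by one, so two of them carry every matrix into \<open>\<B>\<close>.\<close>

lemma whittaker_pair_blockB: "whittaker_pair (blockB :: ('n::finite) gl2 set)"
  unfolding whittaker_pair_def lie_subalgebra_def
proof (intro conjI)
  show "mat_vs.subspace (blockB :: 'n gl2 set)"
    unfolding mat_vs.subspace_def blockB_eq
    by (auto simp: block_mat_add block_mat_mscale simp flip: block_mat_0)
  show "\<forall>X\<in>blockB. \<forall>Y\<in>blockB. lie_bracket X Y \<in> (blockB :: 'n gl2 set)"
    by (auto simp: blockB_eq block_mat_lie_bracket lie_bracket_0)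
  show "\<exists>k. \<forall>Xs. length Xs = k \<and> set Xs \<subseteq> (blockB :: 'n gl2 set)
      \<longrightarrow> (\<forall>Y\<in>blockB. foldr lie_bracket Xs Y = 0)"
    by (intro exI[of _ 1])
      (auto simp: blockB_eq block_mat_lie_bracket lie_bracket_0 length_Suc_conv block_mat_0)
  show "\<exists>k. \<forall>Xs. length Xs = k \<and> set Xs \<subseteq> (blockB :: 'n gl2 set)
      \<longrightarrow> (\<forall>Y. foldr lie_bracket Xs Y \<in> blockB)"
  proof (intro exI[of _ 2] allI impI)
    fix Xs :: "'n gl2 list" and Y :: "'n gl2"
    assume "length Xs = 2 \<and> set Xs \<subseteq> blockB"
    then obtain b b' where Xs: "Xs = [block_mat 0 b 0 0, block_mat 0 b' 0 0]"
      by (auto simp: blockB_eq length_Suc_conv numeral_2_eq_2)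
    obtain a0 b0 c0 d0 where Y: "Y = block_mat a0 b0 c0 d0"
      by (rule block_mat_cases)
    show "foldr lie_bracket Xs Y \<in> blockB"
      by (auto simp: Xs Y blockB_eq block_mat_lie_bracket lie_bracket_0)
  qed
qed

section \<open>The enveloping algebra of \<open>\<A>\<close>\<close>

lemma free_on_induct [consumes 1, case_names single add]:
  assumes "p \<in> free_on L"
    and single: "\<And>w c. set w \<subseteq> L \<Longrightarrow> P (Poly_Mapping.single w c)"
    and add: "\<And>p q. \<lbrakk>p \<in> free_on L; q \<in> free_on L; P p; P q\<rbrakk> \<Longrightarrow> P (p + q)"
  shows "P p"
proof -
  have L: "set w \<subseteq> L" if "w \<in> Poly_Mapping.keys p" for w
    using assms(1) that by (auto simp: free_on_def)
  have free: "Poly_Mapping.single w c \<in> free_on L" if "set w \<subseteq> L" for w :: "'a list" and c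
    using that by (auto simp: free_on_def)
  have sum: "P (\<Sum>w\<in>K. Poly_Mapping.single w (Poly_Mapping.lookup p w))
      \<and> (\<Sum>w\<in>K. Poly_Mapping.single w (Poly_Mapping.lookup p w)) \<in> free_on L"
    if "finite K" "K \<subseteq> Poly_Mapping.keys p" for K
    using that
  proof (induction K)
    case empty
    show ?case using single[of "[]" 0] by simp
  next
    case (insert w K)
    then show ?case
      by (auto intro!: add single free free_on_add L)
  qed
  have "p = (\<Sum>w\<in>Poly_Mapping.keys p. Poly_Mapping.single w (Poly_Mapping.lookup p w))"
  proof (rule poly_mapping_eqI)
    fix k
    have "Poly_Mapping.lookup (\<Sum>w\<in>Poly_Mapping.keys p. Poly_Mapping.single w (Poly_Mapping.lookup p w)) k
        = (\<Sum>w\<in>Poly_Mapping.keys p. if k = w then Poly_Mapping.lookup p k else 0)"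
      unfolding lookup_sum by (intro sum.cong) (auto simp: lookup_single)
    then show "Poly_Mapping.lookup p k
        = Poly_Mapping.lookup (\<Sum>w\<in>Poly_Mapping.keys p. Poly_Mapping.single w (Poly_Mapping.lookup p w)) k"
      by (simp add: in_keys_iff)
  qed
  with sum[of "Poly_Mapping.keys p"] show ?thesis
    by simp
qed

lemma free_on_UNIV [simp]: "p \<in> free_on UNIV"
  by (simp add: free_on_def)

lemma free_const_commute: "free_const c * p = p * free_const c"
proof -
  have "p \<in> free_on UNIV" by simp
  then show ?thesis
    by (induction rule: free_on_induct)
      (simp_all add: free_const_def mult_single plus_list_def algebra_simps)
qed

lemma free_const_add: "free_const (c + d) = free_const c + free_const d"
  by (simp add: free_const_def single_add)

lemma free_const_mult: "free_const (c * d) = free_const c * free_const d"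
  by (simp add: free_const_def mult_single plus_list_def)

lemma free_const_1: "free_const 1 = 1"
  unfolding single_one[symmetric] free_const_def zero_list_def ..

lemma UA_cases:
  obtains p where "u = abs_UA p" "p \<in> free_on blockA" "uea_eq blockA p p"
proof
  show "u = abs_UA (rep_UA u)"
    using Quotient3_abs_rep[OF Quotient3_UA, of u] by simp
  show *: "uea_eq blockA (rep_UA u) (rep_UA u)"
    using Quotient3_rep_reflp[OF Quotient3_UA, of u] .
  then show "rep_UA u \<in> free_on blockA"
    by (simp add: uea_eq_def)
qed

lemma uea_eq_refl_iff: "uea_eq L p p \<longleftrightarrow> p \<in> free_on L"
  by (auto simp: uea_eq_def uea_ideal.zero)

lemma abs_UA_eqI: "uea_eq blockA p q \<Longrightarrow> abs_UA p = abs_UA q"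
  using Quotient3_rel_abs[OF Quotient3_UA] .

lemma abs_UA_add: "p \<in> free_on blockA \<Longrightarrow> q \<in> free_on blockA \<Longrightarrow> abs_UA (p + q) = abs_UA p + abs_UA q"
  and abs_UA_diff: "p \<in> free_on blockA \<Longrightarrow> q \<in> free_on blockA \<Longrightarrow> abs_UA (p - q) = abs_UA p - abs_UA q"
  and abs_UA_mult: "p \<in> free_on blockA \<Longrightarrow> q \<in> free_on blockA \<Longrightarrow> abs_UA (p * q) = abs_UA p * abs_UA q"
  and abs_UA_scale: "p \<in> free_on blockA \<Longrightarrow> abs_UA (free_const c * p) = UA_scale c (abs_UA p)"
  by (simp_all add: plus_UA.abs_eq minus_UA.abs_eq times_UA.abs_eq UA_scale.abs_eq uea_eq_refl_iff)

lemma vector_space_UA_scale: "vector_space (UA_scale :: complex \<Rightarrow> ('n::finite) UA \<Rightarrow> 'n UA)"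
proof
  fix a b :: complex and u v :: "'n UA"
  obtain p q where "u = abs_UA p" "p \<in> free_on blockA" "v = abs_UA q" "q \<in> free_on blockA"
    by (metis UA_cases)
  then show "UA_scale a (u + v) = UA_scale a u + UA_scale a v"
    "UA_scale (a + b) u = UA_scale a u + UA_scale b u"
    "UA_scale a (UA_scale b u) = UA_scale (a * b) u"
    "UA_scale 1 u = u"
    by (simp_all add: free_on_add free_on_mult distrib_left distrib_right free_const_add
        free_const_mult free_const_1 mult.assoc flip: abs_UA_add abs_UA_scale)
qed

interpretation UA_vs: vector_space UA_scale
  by (rule vector_space_UA_scale)

lemma UA_scale_mult_left: "UA_scale c u * v = UA_scale c (u * v)"
proof -
  obtain p q where "u = abs_UA p" "p \<in> free_on blockA" "v = abs_UA q" "q \<in> free_on blockA"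
    by (metis UA_cases)
  then show ?thesis
    by (simp add: free_on_mult mult.assoc flip: abs_UA_mult abs_UA_scale)
qed

lemma UA_scale_mult_right: "u * UA_scale c v = UA_scale c (u * v)"
proof -
  obtain p q where "u = abs_UA p" "p \<in> free_on blockA" "v = abs_UA q" "q \<in> free_on blockA"
    by (metis UA_cases)
  then show ?thesis
    by (simp add: free_on_mult free_const_commute mult.assoc flip: abs_UA_mult abs_UA_scale)
qed

text \<open>Identifying \<open>\<A>\<close> with the \<open>n \<times> n\<close> matrices removes all side conditions about
  membership in \<open>\<A>\<close>.\<close>

definition UA_gen :: "complex^'n^'n \<Rightarrow> ('n::finite) UA" where
  "UA_gen a = UA_incl (block_mat a 0 0 0)"

lemma block_mat_in_blockA [simp]: "block_mat a 0 0 0 \<in> blockA"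
  by (simp add: blockA_eq)

lemma abs_UA_relator:
  assumes "p - q \<in> uea_relators blockA" "p \<in> free_on blockA" "q \<in> free_on blockA"
  shows "abs_UA p = abs_UA q"
  using uea_ideal.step[OF uea_ideal.zero assms(1) free_on_1 free_on_1] assms
  by (intro abs_UA_eqI) (simp add: uea_eq_def)

lemma UA_gen_add: "UA_gen (a + b) = UA_gen a + UA_gen b"
proof -
  let ?X = "block_mat a 0 0 0" and ?Y = "block_mat b 0 0 0"
  have "abs_UA (free_gen (?X + ?Y)) = abs_UA (free_gen ?X + free_gen ?Y)"
  proof (rule abs_UA_relator)
    show "free_gen (?X + ?Y) - (free_gen ?X + free_gen ?Y) \<in> uea_relators blockA"
      unfolding uea_relators_def diff_diff_eq[symmetric] using block_mat_in_blockA by blast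
  qed (simp_all add: free_on_add block_mat_add)
  then show ?thesis
    by (simp add: UA_gen_def UA_incl_def block_mat_add abs_UA_add)
qed

lemma UA_gen_mscale: "UA_gen (mscale c a) = UA_scale c (UA_gen a)"
proof -
  let ?X = "block_mat a 0 0 0"
  have "abs_UA (free_gen (mscale c ?X)) = abs_UA (free_const c * free_gen ?X)"
  proof (rule abs_UA_relator)
    show "free_gen (mscale c ?X) - free_const c * free_gen ?X \<in> uea_relators blockA"
      unfolding uea_relators_def using block_mat_in_blockA by blast
  qed (simp_all add: free_on_mult block_mat_mscale)
  then show ?thesis
    by (simp add: UA_gen_def UA_incl_def block_mat_mscale abs_UA_scale)
qed

lemma UA_gen_lie_bracket: "UA_gen (lie_bracket a b) = UA_gen a * UA_gen b - UA_gen b * UA_gen a"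
proof -
  let ?X = "block_mat a 0 0 0" and ?Y = "block_mat b 0 0 0"
  have XY: "lie_bracket ?X ?Y = block_mat (lie_bracket a b) 0 0 0"
    by (simp add: block_mat_lie_bracket lie_bracket_0)
  have "abs_UA (free_gen ?X * free_gen ?Y - free_gen ?Y * free_gen ?X) = abs_UA (free_gen (lie_bracket ?X ?Y))"
  proof (rule abs_UA_relator)
    show "free_gen ?X * free_gen ?Y - free_gen ?Y * free_gen ?X - free_gen (lie_bracket ?X ?Y)
        \<in> uea_relators blockA"
      unfolding uea_relators_def using block_mat_in_blockA by blast
  qed (simp_all add: free_on_mult free_on_diff XY)
  then show ?thesis
    by (simp add: UA_gen_def UA_incl_def XY abs_UA_diff abs_UA_mult free_on_mult)
qed

lemma UA_gen_uminus: "UA_gen (- a) = - UA_gen a"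
  and UA_gen_0: "UA_gen 0 = 0"
proof -
  show *: "UA_gen 0 = 0"
    using UA_gen_add[of 0 0] by simp
  show "UA_gen (- a) = - UA_gen a"
    using UA_gen_add[of "- a" a] by (simp add: * eq_neg_iff_add_eq_0)
qed

lemma UA_gen_sum: "UA_gen (sum f I) = (\<Sum>i\<in>I. UA_gen (f i))"
  by (induction I rule: infinite_finite_induct) (simp_all add: UA_gen_add UA_gen_0)

lemma UA_incl_eq_UA_gen: "X \<in> blockA \<Longrightarrow> \<exists>a. X = block_mat a 0 0 0 \<and> UA_incl X = UA_gen a"
  by (auto simp: blockA_eq UA_gen_def)

lemma UA_induct [case_names one add scale gen]:
  fixes P :: "('a::finite) UA \<Rightarrow> bool"
  assumes one: "P 1"
    and add: "\<And>u v. P u \<Longrightarrow> P v \<Longrightarrow> P (u + v)"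
    and scale: "\<And>c u. P u \<Longrightarrow> P (UA_scale c u)"
    and gen: "\<And>a u. P u \<Longrightarrow> P (UA_gen a * u)"
  shows "P u"
proof -
  obtain p where u: "u = abs_UA p" and "p \<in> free_on blockA"
    by (rule UA_cases)
  from this(2) have "P (abs_UA p)"
  proof (induction rule: free_on_induct)
    case (single w c)
    have "P (abs_UA (Poly_Mapping.single w 1)) \<and> Poly_Mapping.single w 1 \<in> free_on blockA"
      using single
    proof (induction w)
      case Nil
      have "Poly_Mapping.single [] 1 = (1 :: 'a gl2 list \<Rightarrow>\<^sub>0 complex)"
        using free_const_1 by (simp add: free_const_def)
      then show ?case
        using one by (simp add: one_UA.abs_eq)
    next
      case (Cons X w)
      obtain a where a: "X = block_mat a 0 0 0" "UA_incl X = UA_gen a"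
        using Cons.prems UA_incl_eq_UA_gen[of X] by auto
      have "Poly_Mapping.single (X # w) 1 = free_gen X * Poly_Mapping.single w 1"
        by (simp add: free_gen_def mult_single plus_list_def)
      with Cons gen[of _ a] a show ?case
        by (simp add: free_on_mult abs_UA_mult UA_gen_def UA_incl_def)
    qed
    moreover have "Poly_Mapping.single w c = free_const c * Poly_Mapping.single w 1"
      by (simp add: free_const_def mult_single plus_list_def)
    ultimately show ?case
      by (simp add: abs_UA_scale scale)
  next
    case (add p q)
    then show ?case
      by (simp add: abs_UA_add assms(2))
  qed
  then show ?thesis
    by (simp add: u)
qed

text \<open>The universal property, for a representation on a subspace \<open>W\<close>: a word acts as the
  composition of its letters, and what has to be seen is that the relators act as zero. The
  subspace is there because the representation used below satisfies the axioms only on the linear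
  maps among all functions.\<close>

lemma UA_module_lift:
  fixes s :: "complex \<Rightarrow> 'v::ab_group_add \<Rightarrow> 'v" and T :: "complex^'n::finite^'n \<Rightarrow> 'v \<Rightarrow> 'v"
  assumes s: "vector_space s" and W: "module.subspace s W"
    and T_W: "\<And>a v. v \<in> W \<Longrightarrow> T a v \<in> W"
    and T_add: "\<And>a v v'. v \<in> W \<Longrightarrow> v' \<in> W \<Longrightarrow> T a (v + v') = T a v + T a v'"
    and T_scale: "\<And>a c v. v \<in> W \<Longrightarrow> T a (s c v) = s c (T a v)"
    and add_T: "\<And>a b v. v \<in> W \<Longrightarrow> T (a + b) v = T a v + T b v"
    and mscale_T: "\<And>a c v. v \<in> W \<Longrightarrow> T (mscale c a) v = s c (T a v)"
    and bracket_T: "\<And>a b v. v \<in> W \<Longrightarrow> T (lie_bracket a b) v = T a (T b v) - T b (T a v)"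
  obtains act :: "'n UA \<Rightarrow> 'v \<Rightarrow> 'v" where
    "\<And>u v. v \<in> W \<Longrightarrow> act u v \<in> W"
    "\<And>v. v \<in> W \<Longrightarrow> act 1 v = v"
    "\<And>u u' v. v \<in> W \<Longrightarrow> act (u + u') v = act u v + act u' v"
    "\<And>c u v. v \<in> W \<Longrightarrow> act (UA_scale c u) v = s c (act u v)"
    "\<And>a u v. v \<in> W \<Longrightarrow> act (UA_gen a * u) v = T a (act u v)"
proof -
  interpret V: vector_space s by (rule s)
  have tl: "block_tl (X + Y) = block_tl X + block_tl Y" "block_tl (mscale c X) = mscale c (block_tl X)"
    for X Y :: "'n gl2" and c
    by (simp_all add: block_tl_def vec_eq_iff)
  define T' where "T' X = T (block_tl X)" for X :: "'n gl2"
  define F where "F p v = (\<Sum>w\<in>Poly_Mapping.keys p. s (Poly_Mapping.lookup p w) (foldr T' w v))" for p v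
  have W_foldr: "foldr T' w v \<in> W" if "v \<in> W" for w v
    by (induction w) (simp_all add: that T_W T'_def)
  have W_F: "F p v \<in> W" if "v \<in> W" for p v
    unfolding F_def using that by (intro V.subspace_sum[OF W] V.subspace_scale[OF W] W_foldr)
  have F_superset: "F p v = (\<Sum>w\<in>K. s (Poly_Mapping.lookup p w) (foldr T' w v))"
    if "finite K" "Poly_Mapping.keys p \<subseteq> K" for p v K
    unfolding F_def using that by (intro sum.mono_neutral_left) (auto simp: in_keys_iff)
  have F_add: "F (p + q) v = F p v + F q v" for p q v
  proof -
    let ?K = "Poly_Mapping.keys p \<union> Poly_Mapping.keys q"
    have K: "finite ?K" "Poly_Mapping.keys p \<subseteq> ?K" "Poly_Mapping.keys q \<subseteq> ?K" "Poly_Mapping.keys (p + q) \<subseteq> ?K"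
      using keys_add[of p q] by auto
    then show ?thesis
      by (simp add: F_superset[OF K(1)] lookup_add V.scale_left_distrib sum.distrib)
  qed
  have F_single: "F (Poly_Mapping.single w c) v = s c (foldr T' w v)" for w c v
    by (simp add: F_def)
  have foldr_add: "foldr T' w (v + v') = foldr T' w v + foldr T' w v'" if "v \<in> W" "v' \<in> W" for w v v'
    by (induction w) (simp_all add: T'_def T_add W_foldr[unfolded T'_def] that)
  have foldr_scale: "foldr T' w (s c v) = s c (foldr T' w v)" if "v \<in> W" for w c v
    by (induction w) (simp_all add: T'_def T_scale W_foldr[unfolded T'_def] that)
  have F_single_mult: "F (Poly_Mapping.single w c * q) v = s c (foldr T' w (F q v))" if "v \<in> W" for w c q v
  proof -
    have "q \<in> free_on UNIV" by simp
    then show ?thesis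
      by (induction rule: free_on_induct)
        (simp_all add: mult_single F_single plus_list_def foldr_scale W_foldr that F_add
          distrib_left foldr_add W_F V.scale_right_distrib)
  qed
  have F_gen_mult: "F (free_gen X * q) v = T' X (F q v)" if "v \<in> W" for X q v
    using that by (simp add: free_gen_def F_single_mult)
  have F_const_mult: "F (free_const c * q) v = s c (F q v)" if "v \<in> W" for c q v
    using that by (simp add: free_const_def F_single_mult)
  have F_diff: "F (p - q) v = F p v - F q v" for p q v
    using F_add[of "p - q" q v] by simp
  have F_relator: "F (r * q) v = 0" if r: "r \<in> uea_relators blockA" and v: "v \<in> W" for r q v
  proof -
    have add: "T' (X + Y) x = T' X x + T' Y x" if "x \<in> W" for X Y x
      by (simp add: T'_def tl add_T that)
    have scale: "T' (mscale c X) x = s c (T' X x)" if "x \<in> W" for X c x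
      by (simp add: T'_def tl mscale_T that)
    have bracket: "T' (lie_bracket X Y) x = T' X (T' Y x) - T' Y (T' X x)"
      if "X \<in> blockA" "Y \<in> blockA" "x \<in> W" for X Y x
    proof -
      obtain a b where "X = block_mat a 0 0 0" "Y = block_mat b 0 0 0"
        using \<open>X \<in> blockA\<close> \<open>Y \<in> blockA\<close> by (auto simp: blockA_eq)
      then show ?thesis
        using bracket_T[OF that(3)] by (simp add: T'_def tl block_mat_lie_bracket)
    qed
    show ?thesis
      using r unfolding uea_relators_def
      by (auto simp: left_diff_distrib mult.assoc F_diff F_gen_mult F_const_mult v add scale bracket W_F)
  qed
  have F_mult_zero: "F (p * q) v = 0" if "F q v = 0" "v \<in> W" for p q v
  proof -
    have foldr_0: "foldr T' w 0 = 0" for w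
      using foldr_scale[of v w 0] that(2) by simp
    have "p \<in> free_on UNIV" by simp
    then show ?thesis
      by (induction rule: free_on_induct)
        (simp_all add: distrib_right F_add F_single_mult that foldr_0)
  qed
  have F_ideal: "F p v = 0" if "p \<in> uea_ideal blockA" "v \<in> W" for p v
    using that(1)
  proof induction
    case zero
    show ?case by (simp add: F_def)
  next
    case (step u r p q)
    then show ?case
      using F_mult_zero[of "r * q" v p] that(2) by (simp add: F_add F_relator mult.assoc)
  qed
  define act where "act u v = F (rep_UA u) v" for u v
  have act: "act (abs_UA p) v = F p v" if "p \<in> free_on blockA" "v \<in> W" for p v
  proof -
    have "uea_eq blockA (rep_UA (abs_UA p)) p"
      using Quotient3_rep_abs[OF Quotient3_UA] that(1) uea_eq_refl_iff by blast
    then show ?thesis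
      using F_ideal[of "rep_UA (abs_UA p) - p" v] that(2) by (simp add: uea_eq_def act_def F_diff)
  qed
  show thesis
  proof
    fix u u' :: "'n UA" and v c a assume v: "v \<in> W"
    obtain p p' where p: "u = abs_UA p" "p \<in> free_on blockA" "u' = abs_UA p'" "p' \<in> free_on blockA"
      by (metis UA_cases)
    show "act u v \<in> W"
      using v by (simp add: act_def W_F)
    show "act 1 v = v"
      using v F_single[of "[]" 1 v]
      by (simp add: one_UA.abs_eq act flip: free_const_1 free_const_def)
    show "act (u + u') v = act u v + act u' v"
      using p v by (simp add: act free_on_add F_add flip: abs_UA_add)
    show "act (UA_scale c u) v = s c (act u v)"
      using p v by (simp add: act free_on_mult F_const_mult flip: abs_UA_scale)
    show "act (UA_gen a * u) v = T a (act u v)"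
      using p v by (simp add: act free_on_mult F_gen_mult UA_gen_def UA_incl_def T'_def tl
          flip: abs_UA_mult)
  qed
qed

text \<open>The trivial representation of \<open>\<A>\<close> gives the augmentation.\<close>

lemma UA_counit:
  obtains \<epsilon> :: "('n::finite) UA \<Rightarrow> complex" where
    "\<epsilon> 1 = 1" "\<And>u v. \<epsilon> (u + v) = \<epsilon> u + \<epsilon> v" "\<And>c u. \<epsilon> (UA_scale c u) = c * \<epsilon> u"
    "\<And>a u. \<epsilon> (UA_gen a * u) = 0"
proof -
  have "vector_space ((*) :: complex \<Rightarrow> complex \<Rightarrow> complex)"
    by standard (simp_all add: algebra_simps)
  then interpret C: vector_space "(*) :: complex \<Rightarrow> complex \<Rightarrow> complex" .
  obtain act :: "'n UA \<Rightarrow> complex \<Rightarrow> complex" where act: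
    "\<And>v. act 1 v = v" "\<And>u u' v. act (u + u') v = act u v + act u' v"
    "\<And>c u v. act (UA_scale c u) v = c * act u v" "\<And>a u v. act (UA_gen a * u) v = 0"
    by (rule UA_module_lift[of "(*)" UNIV "\<lambda>_ _. 0"])
      (simp_all add: \<open>vector_space ((*) :: complex \<Rightarrow> complex \<Rightarrow> complex)\<close>, blast)
  show thesis
    by (rule that[of "\<lambda>u. act u 1"]) (simp_all add: act)
qed

section \<open>The filtration by word length\<close>

definition UA_word :: "(complex^'n^'n) list \<Rightarrow> ('n::finite) UA" where
  "UA_word xs = prod_list (map UA_gen xs)"

lemma UA_word_simps [simp]:
  "UA_word [] = 1" "UA_word (a # xs) = UA_gen a * UA_word xs" "UA_word (xs @ ys) = UA_word xs * UA_word ys"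
  by (simp_all add: UA_word_def)

text \<open>The filtration is indexed by a strict bound on the length, so that \<open>UA_below 0\<close> is the zero
  subspace and maps of degree \<open>-1\<close> need no special case at the constants.\<close>

definition UA_below :: "nat \<Rightarrow> ('n::finite) UA set" where
  "UA_below k = UA_vs.span (UA_word ` {xs. length xs < k})"

lemma UA_below_0 [simp]: "UA_below 0 = {0}"
  by (simp add: UA_below_def)

lemma UA_below_mono: "j \<le> k \<Longrightarrow> UA_below j \<subseteq> UA_below k"
  unfolding UA_below_def by (intro UA_vs.span_mono image_mono) auto

lemma subspace_UA_below: "UA_vs.subspace (UA_below k)"
  by (simp add: UA_below_def)

lemmas UA_below_add = UA_vs.subspace_add[OF subspace_UA_below]
  and UA_below_diff = UA_vs.subspace_diff[OF subspace_UA_below]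
  and UA_below_neg = UA_vs.subspace_neg[OF subspace_UA_below]
  and UA_below_scale = UA_vs.subspace_scale[OF subspace_UA_below]
  and UA_below_sum = UA_vs.subspace_sum[OF subspace_UA_below]
  and UA_below_zero = UA_vs.subspace_0[OF subspace_UA_below]

lemma UA_word_in_below: "length xs < k \<Longrightarrow> UA_word xs \<in> UA_below k"
  unfolding UA_below_def by (intro UA_vs.span_base) auto

lemma one_in_UA_below: "1 \<in> UA_below (Suc k)"
  using UA_word_in_below[of "[]" "Suc k"] by simp

lemma UA_below_induct [consumes 1, case_names zero one add scale gen]:
  fixes u :: "('n::finite) UA"
  assumes "u \<in> UA_below k"
    and zero: "\<And>k. P k 0" and one: "\<And>k. P (Suc k) 1"
    and add: "\<And>k u v. \<lbrakk>u \<in> UA_below k; v \<in> UA_below k; P k u; P k v\<rbrakk> \<Longrightarrow> P k (u + v)"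
    and scale: "\<And>k c u. \<lbrakk>u \<in> UA_below k; P k u\<rbrakk> \<Longrightarrow> P k (UA_scale c u)"
    and gen: "\<And>k a u. \<lbrakk>u \<in> UA_below k; P k u\<rbrakk> \<Longrightarrow> P (Suc k) (UA_gen a * u)"
  shows "P k u"
proof -
  have word: "P k (UA_word xs)" if "length xs < k" for xs :: "(complex^'n^'n) list" and k
    using that
  proof (induction xs arbitrary: k)
    case Nil
    then show ?case using one[of "k - 1"] by simp
  next
    case (Cons a xs)
    then obtain k' where "k = Suc k'" "length xs < k'"
      by (cases k) auto
    with Cons.IH show ?case
      by (auto intro!: gen UA_word_in_below)
  qed
  have "u \<in> UA_vs.span (UA_word ` {xs. length xs < k})"
    using assms(1) by (simp add: UA_below_def)
  then have "u \<in> UA_below k \<and> P k u"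
  proof (induction rule: UA_vs.span_induct_alt)
    case base
    show ?case by (simp add: zero UA_below_zero)
  next
    case (step c x y)
    then show ?case
      by (auto intro!: add scale word UA_below_add UA_below_scale UA_word_in_below)
  qed
  then show ?thesis ..
qed

lemma UA_gen_mult_below: "u \<in> UA_below k \<Longrightarrow> UA_gen a * u \<in> UA_below (Suc k)"
proof (induction rule: UA_below_induct)
  case (gen k a' u)
  have "UA_vs.span (UA_word ` {xs. length xs < k}) \<subseteq> {u. UA_gen a * (UA_gen a' * u) \<in> UA_below (Suc (Suc k))}"
  proof (rule UA_vs.span_minimal)
    show "UA_word ` {xs. length xs < k} \<subseteq> {u. UA_gen a * (UA_gen a' * u) \<in> UA_below (Suc (Suc k))}"
      using UA_word_in_below[of "a # a' # _"] by auto
    show "UA_vs.subspace {u. UA_gen a * (UA_gen a' * u) \<in> UA_below (Suc (Suc k))}"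
      by (auto simp: UA_vs.subspace_def distrib_left UA_scale_mult_right
          intro: UA_below_zero UA_below_add UA_below_scale)
  qed
  with gen show ?case
    by (auto simp: UA_below_def)
next
  case (one k)
  show ?case using UA_word_in_below[of "[a]"] by simp
qed (auto simp: distrib_left UA_scale_mult_right intro: UA_below_zero UA_below_add UA_below_scale)

lemma UA_gen_in_below: "UA_gen a \<in> UA_below (Suc (Suc k))"
  using UA_word_in_below[of "[a]"] by simp

lemma UA_in_some_below: obtains k where "u \<in> UA_below (Suc k)"
proof -
  have "\<exists>k. u \<in> UA_below (Suc k)"
  proof (induction rule: UA_induct)
    case (add u v)
    then obtain j k where "u \<in> UA_below (Suc j)" "v \<in> UA_below (Suc k)"
      by blast
    then have "u + v \<in> UA_below (Suc (max j k))"
      using UA_below_mono[of "Suc j" "Suc (max j k)"] UA_below_mono[of "Suc k" "Suc (max j k)"]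
      by (intro UA_below_add) auto
    then show ?case ..
  qed (auto intro: one_in_UA_below UA_below_scale UA_gen_mult_below)
  then show thesis
    using that by blast
qed

lemma UA_below_one: "u \<in> UA_below (Suc 0) \<longleftrightarrow> (\<exists>c. u = UA_scale c 1)"
  by (auto simp: UA_below_def UA_vs.span_singleton)

text \<open>Exchanging two neighbours in a word costs one letter: their commutator is again a
  generator.\<close>

lemma UA_word_move_to_front:
  "UA_word (xs @ a # ys) - UA_word (a # xs @ ys) \<in> UA_below (Suc (length (xs @ ys)))"
proof (induction xs)
  case Nil
  then show ?case by (simp add: UA_below_zero)
next
  case (Cons b xs)
  have "UA_word ((b # xs) @ a # ys) - UA_word (a # (b # xs) @ ys)
      = UA_gen b * (UA_word (xs @ a # ys) - UA_word (a # xs @ ys))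
        + UA_gen (lie_bracket b a) * UA_word (xs @ ys)"
    by (simp add: UA_gen_lie_bracket algebra_simps)
  also have "\<dots> \<in> UA_below (Suc (length ((b # xs) @ ys)))"
  proof (rule UA_below_add)
    show "UA_gen b * (UA_word (xs @ a # ys) - UA_word (a # xs @ ys)) \<in> UA_below (Suc (length ((b # xs) @ ys)))"
      using UA_gen_mult_below[OF Cons.IH] by simp
    show "UA_gen (lie_bracket b a) * UA_word (xs @ ys) \<in> UA_below (Suc (length ((b # xs) @ ys)))"
      by (intro UA_gen_mult_below UA_word_in_below) simp
  qed
  finally show ?case .
qed

lemma UA_word_perm:
  "mset xs = mset ys \<Longrightarrow> UA_word xs - UA_word ys \<in> UA_below (length xs)"
proof (induction xs arbitrary: ys)
  case Nil
  then show ?case by simp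
next
  case (Cons a xs)
  have "a \<in> set ys"
    using Cons.prems by (metis list.set_intros(1) set_mset_mset)
  then obtain ys1 ys2 where ys: "ys = ys1 @ a # ys2"
    by (auto simp: in_set_conv_decomp)
  then have mset: "mset xs = mset (ys1 @ ys2)"
    using Cons.prems by simp
  have "UA_word (a # xs) - UA_word ys = UA_gen a * (UA_word xs - UA_word (ys1 @ ys2))
      - (UA_word (ys1 @ a # ys2) - UA_word (a # ys1 @ ys2))"
    by (simp add: ys algebra_simps)
  also have "\<dots> \<in> UA_below (length (a # xs))"
    using UA_gen_mult_below[OF Cons.IH[OF mset], of a] UA_word_move_to_front[of ys1 a ys2]
      mset_eq_length[OF mset]
    by - (rule UA_below_diff, simp_all)
  finally show ?case .
qed

lemma UA_below_subset_span_words: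
  fixes B :: "(complex^'n::finite^'n) set"
  assumes B: "mat_vs.span B = UNIV"
  shows "UA_below k \<subseteq> UA_vs.span (UA_word ` {xs. set xs \<subseteq> B \<and> length xs < k})"
proof
  let ?S = "\<lambda>k. UA_vs.span (UA_word ` {xs. set xs \<subseteq> B \<and> length xs < k})"
  fix u :: "'n UA"
  assume "u \<in> UA_below k"
  then show "u \<in> ?S k"
  proof (induction rule: UA_below_induct)
    case (one k)
    show ?case
      by (rule UA_vs.span_base) (auto intro!: image_eqI[of _ _ "[]"])
  next
    case (gen k a u)
    have b: "UA_gen b * u \<in> ?S (Suc k)" if "b \<in> B" for b
    proof -
      have "?S k \<subseteq> {u. UA_gen b * u \<in> ?S (Suc k)}"
      proof (rule UA_vs.span_minimal)
        show "UA_word ` {xs. set xs \<subseteq> B \<and> length xs < k} \<subseteq> {u. UA_gen b * u \<in> ?S (Suc k)}"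
          using that by (auto intro!: UA_vs.span_base image_eqI[of _ _ "b # _"])
        show "UA_vs.subspace {u. UA_gen b * u \<in> ?S (Suc k)}"
          by (auto simp: UA_vs.subspace_def distrib_left UA_scale_mult_right
              intro: UA_vs.span_zero UA_vs.span_add UA_vs.span_scale)
      qed
      with gen show ?thesis by auto
    qed
    have "mat_vs.span B \<subseteq> {a. UA_gen a * u \<in> ?S (Suc k)}"
      by (rule mat_vs.span_minimal)
        (auto simp: b mat_vs.subspace_def UA_gen_0 UA_gen_add distrib_right UA_gen_mscale
          UA_scale_mult_left intro: UA_vs.span_zero UA_vs.span_add UA_vs.span_scale)
    then show ?case
      using B by auto
  qed (auto intro: UA_vs.span_zero UA_vs.span_add UA_vs.span_scale)
qed

text \<open>The spanning half of the Poincare-Birkhoff-Witt theorem: it suffices to keep one word for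
  every multiset of basis elements, whatever the chosen order is, because rearranging a word changes
  it by shorter words only.\<close>

lemma UA_below_eq_span_normal_words:
  fixes B :: "(complex^'n::finite^'n) set"
  assumes B: "mat_vs.span B = UNIV"
    and S: "\<And>xs. set xs \<subseteq> B \<Longrightarrow> \<exists>ys\<in>S. mset ys = mset xs"
  shows "UA_below k = UA_vs.span (UA_word ` {ys \<in> S. length ys < k})"
proof
  show "UA_vs.span (UA_word ` {ys \<in> S. length ys < k}) \<subseteq> UA_below k"
    unfolding UA_below_def by (intro UA_vs.span_mono image_mono) auto
  show "UA_below k \<subseteq> UA_vs.span (UA_word ` {ys \<in> S. length ys < k})"
  proof (induction k)
    case 0
    show ?case by (simp add: UA_vs.span_zero)
  next
    case (Suc k)
    let ?S = "\<lambda>k. UA_vs.span (UA_word ` {ys \<in> S. length ys < k})"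
    have "UA_word xs \<in> ?S (Suc k)" if xs: "set xs \<subseteq> B" "length xs < Suc k" for xs
    proof -
      obtain ys where ys: "ys \<in> S" "mset ys = mset xs"
        using S xs by blast
      have "length ys = length xs"
        using ys(2) by (rule mset_eq_length)
      then have 1: "UA_word ys \<in> ?S (Suc k)"
        using ys xs by (intro UA_vs.span_base) auto
      have "UA_word xs - UA_word ys \<in> UA_below k"
        using UA_word_perm[of xs ys] ys(2) UA_below_mono[of "length xs" k] xs(2) by auto
      also have "\<dots> \<subseteq> ?S k" by (rule Suc.IH)
      also have "\<dots> \<subseteq> ?S (Suc k)"
        by (intro UA_vs.span_mono image_mono) auto
      finally have "(UA_word xs - UA_word ys) + UA_word ys \<in> ?S (Suc k)"
        using 1 by (rule UA_vs.span_add)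
      then show ?thesis by simp
    qed
    then have "UA_vs.span (UA_word ` {xs. set xs \<subseteq> B \<and> length xs < Suc k}) \<subseteq> ?S (Suc k)"
      by (intro UA_vs.span_minimal) auto
    with UA_below_subset_span_words[OF B, of "Suc k"] show ?case
      by blast
  qed
qed

lemma ordered_basis_blockA_cases:
  assumes "ordered_basis (blockA :: ('n::finite) gl2 set) bs"
  obtains as where "bs = map (\<lambda>a. block_mat a 0 0 0) as" "distinct as" "mat_vs.span (set as) = UNIV"
proof -
  let ?f = "\<lambda>a :: complex^'n^'n. block_mat a 0 0 0"
  have bs: "distinct bs" "mat_vs.span (set bs) = (blockA :: 'n gl2 set)"
    using assms by (auto simp: ordered_basis_def)
  interpret f: Vector_Spaces.linear mscale mscale ?f
    by unfold_locales (simp_all add: block_mat_add block_mat_mscale)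
  have "set bs \<subseteq> range ?f"
    using mat_vs.span_superset[of "set bs"] bs(2) by (simp add: blockA_eq)
  then obtain as where as: "bs = map ?f as"
    by (metis ex_map_conv rangeE subset_code(1))
  have inj: "inj ?f"
    by (auto simp: inj_on_def)
  have "?f ` mat_vs.span (set as) = ?f ` UNIV"
    using bs(2) f.span_image[of "set as"] by (simp add: as blockA_eq)
  then have "mat_vs.span (set as) = UNIV"
    using inj by (simp add: inj_image_eq_iff)
  then show thesis
    using that as bs(1) by (simp add: distinct_map)
qed

text \<open>In particular the filtration does not depend on the ordered basis, and degrees of maps may be
  computed with arbitrary words.\<close>

lemma PBW_filtration_eq_UA_below:
  assumes "ordered_basis (blockA :: ('n::finite) gl2 set) bs"
  shows "PBW_filtration bs k = (UA_below (Suc k) :: 'n UA set)"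
proof -
  obtain as where as: "bs = map (\<lambda>a. block_mat a 0 0 0) as" "distinct as" "mat_vs.span (set as) = UNIV"
    using assms by (rule ordered_basis_blockA_cases)
  define W where "W es = concat (map2 (\<lambda>a e. replicate e a) as es)" for es
  have monomial: "PBW_monomial bs es = UA_word (W es)" for es
  proof -
    have "prod_list (map2 (\<lambda>X e. UA_incl X ^ e) (map (\<lambda>a. block_mat a 0 0 0) xs) es)
        = UA_word (concat (map2 (\<lambda>a e. replicate e a) xs es))" for xs :: "(complex^'n^'n) list"
    proof (induction xs arbitrary: es)
      case (Cons a xs)
      have "UA_word (replicate e a) = UA_gen a ^ e" for e
        by (induction e) simp_all
      with Cons show ?case
        by (cases es) (simp_all add: UA_gen_def)
    qed simp
    then show ?thesis
      by (simp add: PBW_monomial_def W_def as(1))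
  qed
  have length: "length (W es) = sum_list es" if "length es = length as" for es
    using that unfolding W_def by (induction es as rule: list_induct2) simp_all
  have normal: "\<exists>ys\<in>W ` {es. length es = length as}. mset ys = mset xs" if xs: "set xs \<subseteq> set as" for xs
  proof (intro bexI imageI CollectI)
    have "count (mset (concat (map2 (\<lambda>a e. replicate e a) zs (map (count_list xs) zs)))) x
        = (if x \<in> set zs then count_list xs x else 0)" if "distinct zs" for x zs
      using that by (induction zs) (auto simp: count_list_0_iff)
    with as(2) xs show "mset (W (map (count_list xs) as)) = mset xs"
      unfolding W_def by (intro multiset_eqI) (auto simp: count_mset count_list_0_iff)
  qed simp
  have "PBW_filtration bs k
      = UA_vs.span (UA_word ` {ys \<in> W ` {es. length es = length as}. length ys < Suc k})"
  proof -
    have "{ys \<in> W ` {es. length es = length as}. length ys < Suc k}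
        = W ` {es. length es = length bs \<and> sum_list es \<le> k}"
      using length as(1) by auto
    then show ?thesis
      unfolding PBW_filtration_def monomial by (auto intro!: arg_cong[of _ _ UA_vs.span])
  qed
  then show ?thesis
    using UA_below_eq_span_normal_words[OF as(3) normal, of "Suc k"] by simp
qed

section \<open>Extending the left regular action\<close>

text \<open>If \<open>\<A>\<close> acts on \<open>U(\<A>)\<close> by left multiplication, then operators for the elements of a larger
  Lie algebra that have the right commutators with \<open>\<A>\<close> are determined by the images \<open>\<theta> X\<close> of
  \<open>1\<close>. They exist for every linear \<open>\<theta>\<close>, though without the commutators among themselves:
  the linear maps \<open>F\<close> from the large algebra to \<open>U(\<A>)\<close> form a representation of \<open>\<A>\<close> (the
  tensor product of the left regular and the coadjoint one), and \<open>u \<mapsto> u \<cdot> \<theta>\<close> collects the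
  values of all elements on \<open>u\<close>.\<close>

lemma left_regular_extension:
  fixes \<theta> :: "('n::finite) gl2 \<Rightarrow> 'n UA"
  assumes \<theta>: "Vector_Spaces.linear mscale UA_scale \<theta>"
  obtains \<rho> :: "'n gl2 \<Rightarrow> 'n UA \<Rightarrow> 'n UA" where
    "\<And>X. \<rho> X 1 = \<theta> X"
    "\<And>X a u. \<rho> X (UA_gen a * u) = UA_gen a * \<rho> X u + \<rho> (lie_bracket X (block_mat a 0 0 0)) u"
    "\<And>X u v. \<rho> X (u + v) = \<rho> X u + \<rho> X v"
    "\<And>X c u. \<rho> X (UA_scale c u) = UA_scale c (\<rho> X u)"
    "\<And>X Y u. \<rho> (X + Y) u = \<rho> X u + \<rho> Y u"
    "\<And>c X u. \<rho> (mscale c X) u = UA_scale c (\<rho> X u)"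
proof -
  define s where "s c F = (\<lambda>X. UA_scale c (F X))" for c and F :: "'n gl2 \<Rightarrow> 'n UA"
  define W where "W = {F :: 'n gl2 \<Rightarrow> 'n UA.
    (\<forall>X Y. F (X + Y) = F X + F Y) \<and> (\<forall>c X. F (mscale c X) = UA_scale c (F X))}"
  define T where "T a F = (\<lambda>X. UA_gen a * F X + F (lie_bracket X (block_mat a 0 0 0)))"
    for a and F :: "'n gl2 \<Rightarrow> 'n UA"
  have s: "vector_space s"
    by standard (simp_all add: s_def fun_eq_iff UA_vs.scale_left_distrib UA_vs.scale_right_distrib)
  interpret V: vector_space s by (rule s)
  have W_neg: "F (- X) = - F X" if "F \<in> W" for F X
  proof -
    have add: "F (X + Y) = F X + F Y" for X Y
      using that by (simp add: W_def)
    show ?thesis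
      using add[of 0 0] add[of "- X" X] by (simp add: eq_neg_iff_add_eq_0)
  qed
  have gen_add: "block_mat (a + b) 0 0 0 = block_mat a 0 0 0 + block_mat b 0 0 0"
    and gen_mscale: "block_mat (mscale c a) 0 0 0 = mscale c (block_mat a 0 0 0)"
    and gen_bracket: "block_mat (lie_bracket a b) 0 0 0 = lie_bracket (block_mat a 0 0 0) (block_mat b 0 0 0)"
    for a b :: "complex^'n^'n" and c
    by (simp_all add: block_mat_add block_mat_mscale block_mat_lie_bracket lie_bracket_0)
  have \<theta>_W: "\<theta> \<in> W"
  proof -
    interpret Vector_Spaces.linear mscale UA_scale \<theta> by (rule \<theta>)
    show ?thesis by (simp add: W_def add scale)
  qed
  obtain act :: "'n UA \<Rightarrow> ('n gl2 \<Rightarrow> 'n UA) \<Rightarrow> 'n gl2 \<Rightarrow> 'n UA" where act: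
    "\<And>u F. F \<in> W \<Longrightarrow> act u F \<in> W"
    "\<And>F. F \<in> W \<Longrightarrow> act 1 F = F"
    "\<And>u u' F. F \<in> W \<Longrightarrow> act (u + u') F = act u F + act u' F"
    "\<And>c u F. F \<in> W \<Longrightarrow> act (UA_scale c u) F = s c (act u F)"
    "\<And>a u F. F \<in> W \<Longrightarrow> act (UA_gen a * u) F = T a (act u F)"
  proof (rule UA_module_lift[OF s])
    show "V.subspace W"
      by (auto simp: V.subspace_def W_def s_def UA_vs.scale_right_distrib mult.commute algebra_simps)
    fix a b :: "complex^'n^'n" and F F' c
    assume F: "F \<in> W"
    have F': "F (X + Y) = F X + F Y" "F (mscale c X) = UA_scale c (F X)" for X Y c
      using F by (simp_all add: W_def)
    show "T a F \<in> W"
      by (simp add: W_def T_def F' lie_bracket_add_left lie_bracket_mscale_left distrib_left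
          UA_scale_mult_right UA_vs.scale_right_distrib)
    show "T a (F + F') = T a F + T a F'"
      by (simp add: T_def fun_eq_iff distrib_left)
    show "T a (s c F) = s c (T a F)"
      by (simp add: T_def s_def fun_eq_iff UA_scale_mult_right UA_vs.scale_right_distrib)
    show "T (a + b) F = T a F + T b F"
      by (simp add: T_def fun_eq_iff gen_add lie_bracket_add_right F' UA_gen_add distrib_right)
    show "T (mscale c a) F = s c (T a F)"
      by (simp add: T_def s_def fun_eq_iff gen_mscale lie_bracket_mscale_right F' UA_gen_mscale
          UA_scale_mult_left UA_vs.scale_right_distrib)
    show "T (lie_bracket a b) F = T a (T b F) - T b (T a F)"
    proof
      fix X
      let ?a = "block_mat a 0 0 0" and ?b = "block_mat b 0 0 0"
      have "lie_bracket X (lie_bracket ?a ?b)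
          = lie_bracket (lie_bracket X ?a) ?b + - lie_bracket (lie_bracket X ?b) ?a"
        using lie_bracket_jacobi[of X ?a ?b] lie_bracket_anticomm[of ?a] by simp
      then have "F (lie_bracket X (lie_bracket ?a ?b))
          = F (lie_bracket (lie_bracket X ?a) ?b) - F (lie_bracket (lie_bracket X ?b) ?a)"
        by (simp only: F' W_neg[OF F]) simp
      then show "T (lie_bracket a b) F X = (T a (T b F) - T b (T a F)) X"
        by (simp add: T_def gen_bracket UA_gen_lie_bracket algebra_simps)
    qed
  qed (rule that)
  show thesis
  proof (rule that[of "\<lambda>X u. act u \<theta> X"])
    show "act u \<theta> (X + Y) = act u \<theta> X + act u \<theta> Y"
      and "act u \<theta> (mscale c X) = UA_scale c (act u \<theta> X)" for X Y c u
      using act(1)[OF \<theta>_W, of u] by (simp_all add: W_def)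
  qed (simp_all add: act \<theta>_W T_def s_def)
qed


section \<open>The module attached to an invertible matrix\<close>

text \<open>The map \<open>\<theta>\<close> below gives the images of \<open>1\<close>. On \<open>\<B>\<close> it is the character
  \<open>b \<mapsto> trace (Q b)\<close>; the elements of \<open>\<A> \<oplus> \<D>\<close> that fix this character are the
  \<open>a + Q a P\<close> with \<open>P\<close> the inverse of \<open>Q\<close>, and they are made to annihilate \<open>1\<close>. On \<open>\<C>\<close> the
  commutators with \<open>\<B>\<close> determine it up to scalars. The outcome is the quadratic Casimir tensor with
  one leg multiplied by \<open>P c\<close>, and a linear correction.\<close>

locale whittaker_datum =
  fixes Q P :: "complex^'n::finite^'n"
  assumes QP: "Q ** P = mat 1" and PQ: "P ** Q = mat 1"
begin

definition quad :: "complex^'n^'n \<Rightarrow> 'n UA" where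
  "quad N = (\<Sum>i\<in>UNIV. \<Sum>j\<in>UNIV. UA_gen (elem_mat i j) * UA_gen (N ** elem_mat j i))"

definition \<theta> :: "'n gl2 \<Rightarrow> 'n UA" where
  "\<theta> X = UA_gen (block_tl X) + UA_scale (trace (Q ** block_tr X)) 1
     - (quad (P ** block_bl X) + UA_scale (of_nat CARD('n)) (UA_gen (P ** block_bl X)))
     - UA_gen (P ** block_br X ** Q)"

lemma quad_add: "quad (M + N) = quad M + quad N"
  and quad_mscale: "quad (mscale c N) = UA_scale c (quad N)"
  by (simp_all add: quad_def matrix_add_rdistrib UA_gen_add distrib_left sum.distrib
      mscale_mult_left UA_gen_mscale UA_scale_mult_right UA_vs.scale_sum_right)

lemma linear_\<theta>: "Vector_Spaces.linear mscale UA_scale \<theta>"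
proof
  fix X Y :: "'n gl2" and r
  obtain a b c d a' b' c' d' where X: "X = block_mat a b c d" and Y: "Y = block_mat a' b' c' d'"
    by (metis block_mat_cases)
  show "\<theta> (X + Y) = \<theta> X + \<theta> Y"
    by (simp add: X Y \<theta>_def block_mat_add matrix_add_ldistrib matrix_add_rdistrib trace_add
        UA_gen_add quad_add UA_vs.scale_right_distrib UA_vs.scale_left_distrib)
  show "\<theta> (mscale r X) = UA_scale r (\<theta> X)"
    by (simp add: X \<theta>_def block_mat_mscale mscale_mult_left mscale_mult_right trace_mscale
        UA_gen_mscale quad_mscale UA_vs.scale_right_distrib UA_vs.scale_right_diff_distrib
        mult.commute)
qed

text \<open>The equations determine \<open>\<rho>\<close>, by induction over \<open>U(\<A>)\<close>.\<close>

definition \<rho> :: "'n gl2 \<Rightarrow> 'n UA \<Rightarrow> 'n UA" where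
  "\<rho> = (SOME \<rho>. (\<forall>X. \<rho> X 1 = \<theta> X) \<and>
     (\<forall>X a u. \<rho> X (UA_gen a * u) = UA_gen a * \<rho> X u + \<rho> (lie_bracket X (block_mat a 0 0 0)) u) \<and>
     (\<forall>X u v. \<rho> X (u + v) = \<rho> X u + \<rho> X v) \<and> (\<forall>X c u. \<rho> X (UA_scale c u) = UA_scale c (\<rho> X u)) \<and>
     (\<forall>X Y u. \<rho> (X + Y) u = \<rho> X u + \<rho> Y u) \<and> (\<forall>c X u. \<rho> (mscale c X) u = UA_scale c (\<rho> X u)))"

lemma \<rho>_one: "\<rho> X 1 = \<theta> X"
  and \<rho>_gen: "\<rho> X (UA_gen a * u) = UA_gen a * \<rho> X u + \<rho> (lie_bracket X (block_mat a 0 0 0)) u"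
  and \<rho>_add: "\<rho> X (u + v) = \<rho> X u + \<rho> X v"
  and \<rho>_scale: "\<rho> X (UA_scale c u) = UA_scale c (\<rho> X u)"
  and \<rho>_add_left: "\<rho> (X + Y) u = \<rho> X u + \<rho> Y u"
  and \<rho>_mscale: "\<rho> (mscale c X) u = UA_scale c (\<rho> X u)"
proof -
  have "\<exists>\<rho>. (\<forall>X. \<rho> X 1 = \<theta> X) \<and>
     (\<forall>X a u. \<rho> X (UA_gen a * u) = UA_gen a * \<rho> X u + \<rho> (lie_bracket X (block_mat a 0 0 0)) u) \<and>
     (\<forall>X u v. \<rho> X (u + v) = \<rho> X u + \<rho> X v) \<and> (\<forall>X c u. \<rho> X (UA_scale c u) = UA_scale c (\<rho> X u)) \<and>
     (\<forall>X Y u. \<rho> (X + Y) u = \<rho> X u + \<rho> Y u) \<and> (\<forall>c X u. \<rho> (mscale c X) u = UA_scale c (\<rho> X u))"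
    by (rule left_regular_extension[OF linear_\<theta>]) blast
  from someI_ex[OF this, folded \<rho>_def]
  show "\<rho> X 1 = \<theta> X"
    "\<rho> X (UA_gen a * u) = UA_gen a * \<rho> X u + \<rho> (lie_bracket X (block_mat a 0 0 0)) u"
    "\<rho> X (u + v) = \<rho> X u + \<rho> X v" "\<rho> X (UA_scale c u) = UA_scale c (\<rho> X u)"
    "\<rho> (X + Y) u = \<rho> X u + \<rho> Y u" "\<rho> (mscale c X) u = UA_scale c (\<rho> X u)"
    by blast+
qed

lemma linear_\<rho>: "Vector_Spaces.linear UA_scale UA_scale (\<rho> X)"
  by standard (simp_all add: \<rho>_add \<rho>_scale)

lemma linear_\<rho>_left: "Vector_Spaces.linear mscale UA_scale (\<lambda>X. \<rho> X u)"
  by standard (simp_all add: \<rho>_add_left \<rho>_mscale)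

lemmas \<rho>_zero = module_hom.zero[OF linear_\<rho>[unfolded linear_iff_module_hom]]
  and \<rho>_diff = module_hom.diff[OF linear_\<rho>[unfolded linear_iff_module_hom]]
  and \<rho>_neg_left = module_hom.neg[OF linear_\<rho>_left[unfolded linear_iff_module_hom]]

lemma \<rho>_A: "\<rho> (block_mat a 0 0 0) u = UA_gen a * u"
proof (induction u arbitrary: a rule: UA_induct)
  case (gen a' u)
  then show ?case
    by (simp add: \<rho>_gen block_mat_lie_bracket lie_bracket_0 UA_gen_lie_bracket algebra_simps)
qed (simp_all add: \<rho>_one \<theta>_def quad_def UA_gen_0 \<rho>_add \<rho>_scale distrib_left UA_scale_mult_right)

lemma \<rho>_B_one: "\<rho> (block_mat 0 b 0 0) 1 = UA_scale (trace (Q ** b)) 1"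
  by (simp add: \<rho>_one \<theta>_def quad_def UA_gen_0)

lemma \<rho>_B_gen: "\<rho> (block_mat 0 b 0 0) (UA_gen a * u)
    = UA_gen a * \<rho> (block_mat 0 b 0 0) u - \<rho> (block_mat 0 (a ** b) 0 0) u"
proof -
  have "block_mat 0 (- (a ** b)) 0 0 = - block_mat 0 (a ** b) 0 0"
    by (simp add: block_mat_uminus)
  then show ?thesis
    by (simp add: \<rho>_gen block_mat_lie_bracket lie_bracket_0 \<rho>_neg_left)
qed

section \<open>Lowering operators\<close>

text \<open>On the associated graded algebra, which is commutative, the operator \<open>lower b\<close> is the
  derivation that contracts with the linear form \<open>a \<mapsto> trace (Q a b)\<close>. As \<open>Q\<close> is
  invertible, the \<open>lower (elem_mat j i ** P)\<close> are the partial derivatives with respect to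
  the matrix units.\<close>

definition lower :: "complex^'n^'n \<Rightarrow> 'n UA \<Rightarrow> 'n UA" where
  "lower b u = UA_scale (trace (Q ** b)) u - \<rho> (block_mat 0 b 0 0) u"

lemma lower_one: "lower b 1 = 0"
  by (simp add: lower_def \<rho>_B_one)

lemma lower_gen:
  "lower b (UA_gen a * u) = UA_gen a * lower b u + UA_scale (trace (Q ** a ** b)) u - lower (a ** b) u"
  by (simp add: lower_def \<rho>_B_gen algebra_simps UA_scale_mult_right matrix_mul_assoc)

lemma lower_add: "lower b (u + v) = lower b u + lower b v"
  and lower_scale: "lower b (UA_scale c u) = UA_scale c (lower b u)"
  by (simp_all add: lower_def \<rho>_add \<rho>_scale UA_vs.scale_right_distrib
      UA_vs.scale_right_diff_distrib mult.commute)

lemma lower_zero: "lower b 0 = 0"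
  using lower_add[of b 0 0] by simp

lemma lower_neg: "lower b (- u) = - lower b u"
  using lower_add[of b u "- u"] by (simp add: lower_zero eq_neg_iff_add_eq_0 add.commute)

lemma lower_diff: "lower b (u - v) = lower b u - lower b v"
  using lower_add[of b u "- v"] by (simp add: lower_neg)

lemma lower_sum: "lower b (sum f I) = (\<Sum>i\<in>I. lower b (f i))"
  by (induction I rule: infinite_finite_induct) (simp_all add: lower_add lower_zero)

lemma lower_below: "u \<in> UA_below k \<Longrightarrow> lower b u \<in> UA_below (k - 1)"
proof (induction arbitrary: b rule: UA_below_induct)
  case (gen k a u)
  show ?case
  proof (cases k)
    case 0
    then show ?thesis
      using gen.hyps by (simp add: lower_zero)
  next
    case (Suc k')
    have "UA_gen a * lower b u + UA_scale (trace (Q ** a ** b)) u - lower (a ** b) u \<in> UA_below k"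
      using gen UA_gen_mult_below[of "lower b u" k' a] UA_below_mono[of k' k]
      by (intro UA_below_diff UA_below_add UA_below_scale) (auto simp: Suc)
    then show ?thesis
      by (simp add: lower_gen)
  qed
qed (auto simp: lower_zero lower_one lower_add lower_scale intro: UA_below_zero UA_below_add UA_below_scale)

text \<open>On polynomials, the sum of all variables times their partial derivatives multiplies degree \<open>k\<close>
  by \<open>k\<close>.\<close>

lemma euler_lower:
  assumes "u \<in> UA_below (Suc k)"
  shows "(\<Sum>i\<in>UNIV. \<Sum>j\<in>UNIV. UA_gen (elem_mat i j) * lower (elem_mat j i ** P) u)
    - UA_scale (of_nat k) u \<in> UA_below k"
proof -
  define eul where
    "eul u = (\<Sum>i\<in>UNIV. \<Sum>j\<in>UNIV. UA_gen (elem_mat i j) * lower (elem_mat j i ** P) u)" for u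
  have eul_add: "eul (u + v) = eul u + eul v" and eul_scale: "eul (UA_scale c u) = UA_scale c (eul u)"
    for u v c
    by (simp_all add: eul_def lower_add lower_scale distrib_left sum.distrib UA_scale_mult_right
        UA_vs.scale_sum_right)
  have eul_zero: "eul 0 = 0"
    using eul_add[of 0 0] by simp
  have "eul u - UA_scale (of_nat (m - 1)) u \<in> UA_below (m - 1)" if "u \<in> UA_below m" for u m
    using that
  proof (induction rule: UA_below_induct)
    case (zero k)
    show ?case by (simp add: eul_zero UA_below_zero)
  next
    case (one k)
    have "eul 1 = 0"
      by (simp add: eul_def lower_one)
    then show ?case
      using one_in_UA_below[of "k - 1"]
      by (cases k) (auto simp: UA_below_zero intro: UA_below_neg UA_below_scale)
  next
    case (add k u v)
    then show ?case
      using UA_below_add[OF add(3,4)] by (simp add: eul_add algebra_simps)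
  next
    case (scale k c u)
    then show ?case
      using UA_below_scale[OF scale(2), of c] by (simp add: eul_scale algebra_simps)
  next
    case (gen m a u)
    show ?case
    proof (cases m)
      case 0
      with gen have "u = 0" by simp
      then show ?thesis by (simp add: eul_zero UA_below_zero)
    next
      case (Suc k)
      \<comment> \<open>The terms of degree below \<open>m\<close> that come from moving \<open>a\<close> to the left and from the correction
        in the product rule for \<open>lower\<close>.\<close>
      define r where "r i j = UA_gen (lie_bracket (elem_mat i j) a) * lower (elem_mat j i ** P) u
          - UA_gen (elem_mat i j) * lower (a ** elem_mat j i ** P) u" for i j
      have low: "lower b u \<in> UA_below k" for b
        using lower_below[OF gen.hyps, of b] by (simp add: Suc)
      have r: "r i j \<in> UA_below m" for i j
        unfolding r_def Suc by (intro UA_below_diff UA_gen_mult_below low)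
      have tr: "trace (Q ** a ** elem_mat j i ** P) = a $ i $ j" for i j
      proof -
        have "trace (Q ** a ** elem_mat j i ** P) = trace (Q ** (a ** elem_mat j i ** P))"
          by (simp add: matrix_mul_assoc)
        also have "\<dots> = trace (a ** elem_mat j i ** (P ** Q))"
          by (subst trace_mul_sym) (simp add: matrix_mul_assoc)
        finally show ?thesis
          by (simp add: PQ trace_mult_elem_mat)
      qed
      have "eul (UA_gen a * u) = (\<Sum>i\<in>UNIV. \<Sum>j\<in>UNIV. UA_gen a * (UA_gen (elem_mat i j) * lower (elem_mat j i ** P) u)
          + UA_gen (mscale (a $ i $ j) (elem_mat i j)) * u + r i j)"
        unfolding eul_def
        by (intro sum.cong refl)
          (simp add: lower_gen tr r_def UA_gen_lie_bracket UA_gen_mscale UA_scale_mult_left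
            UA_scale_mult_right matrix_mul_assoc algebra_simps)
      also have "\<dots> = UA_gen a * eul u + UA_gen (\<Sum>i\<in>UNIV. \<Sum>j\<in>UNIV. mscale (a $ i $ j) (elem_mat i j)) * u
          + (\<Sum>i\<in>UNIV. \<Sum>j\<in>UNIV. r i j)"
        by (simp add: sum.distrib eul_def sum_distrib_left sum_distrib_right UA_gen_sum)
      also have "\<dots> = UA_gen a * (eul u - UA_scale (of_nat k) u) + (\<Sum>i\<in>UNIV. \<Sum>j\<in>UNIV. r i j)
          + UA_scale (of_nat m) (UA_gen a * u)"
        unfolding mat_eq_sum_elem_mat[of a, symmetric]
        by (simp add: Suc UA_vs.scale_left_distrib UA_scale_mult_right algebra_simps)
      finally have *: "eul (UA_gen a * u) - UA_scale (of_nat m) (UA_gen a * u)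
          = UA_gen a * (eul u - UA_scale (of_nat k) u) + (\<Sum>i\<in>UNIV. \<Sum>j\<in>UNIV. r i j)"
        by simp
      have "UA_gen a * (eul u - UA_scale (of_nat k) u) \<in> UA_below m"
        using UA_gen_mult_below[OF gen.IH, of a] by (simp add: Suc)
      then show ?thesis
        using * r by (auto intro!: UA_below_add UA_below_sum)
    qed
  qed
  from this[OF assms] show ?thesis
    by (simp add: eul_def)
qed

text \<open>If all derivatives vanish, then Euler's identity says that \<open>k u\<close> has degree below \<open>k\<close>; so the
  degree of \<open>u\<close> drops until it is zero.\<close>

lemma lower_eq_0_imp_scalar:
  assumes "\<And>b. lower b u = 0"
  shows "\<exists>c. u = UA_scale c 1"
proof -
  have "u \<in> UA_below (Suc 0)" if "u \<in> UA_below (Suc k)" for k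
    using that
  proof (induction k)
    case (Suc k)
    have "- UA_scale (of_nat (Suc k)) u \<in> UA_below (Suc k)"
      using euler_lower[OF Suc.prems] by (simp add: assms)
    then have "UA_scale (- inverse (of_nat (Suc k))) (- UA_scale (of_nat (Suc k)) u) \<in> UA_below (Suc k)"
      by (rule UA_below_scale)
    then have "u \<in> UA_below (Suc k)"
      by (simp add: UA_vs.scale_minus_right del: of_nat_Suc)
    then show ?case by (rule Suc.IH)
  qed
  then show ?thesis
    using UA_in_some_below[of u] UA_below_one by metis
qed


section \<open>The commutation relations\<close>

definition rel :: "'n gl2 \<Rightarrow> 'n gl2 \<Rightarrow> 'n UA \<Rightarrow> 'n UA" where
  "rel X Y u = \<rho> (lie_bracket X Y) u - \<rho> X (\<rho> Y u) + \<rho> Y (\<rho> X u)"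

lemma rel_antisym: "rel X Y u = - rel Y X u"
  unfolding rel_def lie_bracket_anticomm[of X Y] by (simp add: \<rho>_neg_left)

lemma rel_add_left: "rel (X + X') Y u = rel X Y u + rel X' Y u"
  by (simp add: rel_def lie_bracket_add_left \<rho>_add_left \<rho>_add algebra_simps)

lemma rel_add_right: "rel X (Y + Y') u = rel X Y u + rel X Y' u"
  by (simp add: rel_def lie_bracket_add_right \<rho>_add_left \<rho>_add algebra_simps)

text \<open>By the Jacobi identity the defect of the relations is itself compatible with left
  multiplication by \<open>\<A>\<close>; so it vanishes as soon as it vanishes at \<open>1\<close>.\<close>

lemma rel_gen: "rel X Y (UA_gen a * u) = UA_gen a * rel X Y u
    + rel (lie_bracket X (block_mat a 0 0 0)) Y u + rel X (lie_bracket Y (block_mat a 0 0 0)) u"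
proof -
  let ?a = "block_mat a 0 0 0"
  have "lie_bracket (lie_bracket X Y) ?a
      = lie_bracket (lie_bracket X ?a) Y + lie_bracket X (lie_bracket Y ?a)"
    using lie_bracket_jacobi[of X Y ?a] lie_bracket_anticomm[of "lie_bracket X ?a" Y] by simp
  then show ?thesis
    by (simp add: rel_def \<rho>_gen \<rho>_add \<rho>_add_left algebra_simps)
qed

lemma rel_add: "rel X Y (u + v) = rel X Y u + rel X Y v"
  and rel_scale: "rel X Y (UA_scale c u) = UA_scale c (rel X Y u)"
  by (simp_all add: rel_def \<rho>_add \<rho>_scale UA_vs.scale_right_distrib UA_vs.scale_right_diff_distrib)

lemma rel_eq_0_if_at_one:
  assumes S: "\<And>X a. X \<in> S \<Longrightarrow> lie_bracket X (block_mat a 0 0 0) \<in> S"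
    and T: "\<And>Y a. Y \<in> T \<Longrightarrow> lie_bracket Y (block_mat a 0 0 0) \<in> T"
    and one: "\<And>X Y. X \<in> S \<Longrightarrow> Y \<in> T \<Longrightarrow> rel X Y 1 = 0"
    and "X \<in> S" "Y \<in> T"
  shows "rel X Y u = 0"
  using assms(4,5)
proof (induction u arbitrary: X Y rule: UA_induct)
  case (gen a u)
  then show ?case
    by (simp add: rel_gen S T)
qed (simp_all add: one rel_add rel_scale)

lemma rel_A: "rel (block_mat a 0 0 0) Y u = 0"
  using lie_bracket_anticomm[of "block_mat a 0 0 0" Y] by (simp add: rel_def \<rho>_A \<rho>_gen \<rho>_neg_left)

lemma lower_UA_gen: "lower b (UA_gen a) = UA_scale (trace (Q ** a ** b)) 1"
  using lower_gen[of b a 1] by (simp add: lower_one)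

text \<open>The summand with the factor \<open>CARD('n)\<close> below is the reason for the linear correction in \<open>\<theta>\<close>,
  which cancels it.\<close>

lemma lower_quad:
  "lower b (quad N) = UA_gen (b ** Q ** N) + UA_gen (N ** b ** Q)
     - UA_scale (of_nat CARD('n) * trace (Q ** N ** b)) 1"
proof -
  have pair: "lower b (UA_gen x * UA_gen y) = UA_gen (mscale (trace (Q ** y ** b)) x)
      + UA_gen (mscale (trace (Q ** x ** b)) y) - UA_scale (trace (Q ** y ** x ** b)) 1" for x y
    by (simp add: lower_gen lower_UA_gen UA_scale_mult_right UA_gen_mscale matrix_mul_assoc)
  have t1: "trace (Q ** (N ** elem_mat j i) ** b) = (b ** Q ** N) $ i $ j" for i j
    by (subst trace_mul_sym) (simp add: matrix_mul_assoc trace_mult_elem_mat)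
  have t2: "trace (Q ** elem_mat i j ** b) = (b ** Q) $ j $ i" for i j
    by (subst trace_mul_sym) (simp add: matrix_mul_assoc trace_mult_elem_mat)
  have t3: "trace (Q ** (N ** elem_mat j i) ** elem_mat i j ** b) = (b ** Q ** N) $ j $ j" for i j
  proof -
    have "Q ** (N ** elem_mat j i) ** elem_mat i j ** b = (Q ** N) ** (elem_mat j i ** elem_mat i j) ** b"
      by (simp only: matrix_mul_assoc)
    also have "trace \<dots> = trace (b ** (Q ** N ** elem_mat j j))"
      by (subst trace_mul_sym) (simp add: elem_mat_mult_elem_mat)
    finally show ?thesis
      by (simp add: matrix_mul_assoc trace_mult_elem_mat)
  qed
  have s1: "(\<Sum>i\<in>UNIV. \<Sum>j\<in>UNIV. UA_gen (mscale ((b ** Q ** N) $ i $ j) (elem_mat i j))) = UA_gen (b ** Q ** N)"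
    unfolding UA_gen_sum[symmetric] mat_eq_sum_elem_mat[symmetric] ..
  have s2: "(\<Sum>i\<in>UNIV. \<Sum>j\<in>UNIV. UA_gen (mscale ((b ** Q) $ j $ i) (N ** elem_mat j i))) = UA_gen (N ** b ** Q)"
  proof -
    have "(\<Sum>i\<in>UNIV. \<Sum>j\<in>UNIV. mscale ((b ** Q) $ j $ i) (N ** elem_mat j i))
        = N ** (\<Sum>j\<in>UNIV. \<Sum>i\<in>UNIV. mscale ((b ** Q) $ j $ i) (elem_mat j i))"
    proof -
      have sum: "N ** sum f I = (\<Sum>i\<in>I. N ** f i)" for f :: "'n \<Rightarrow> complex^'n^'n" and I
        by (induction I rule: infinite_finite_induct) (simp_all add: matrix_add_ldistrib)
      show ?thesis
        by (subst sum.swap) (simp add: sum mscale_mult_right)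
    qed
    then show ?thesis
      unfolding UA_gen_sum[symmetric] mat_eq_sum_elem_mat[symmetric] by (simp add: matrix_mul_assoc)
  qed
  have s3: "(\<Sum>i\<in>(UNIV :: 'n set). \<Sum>j\<in>UNIV. UA_scale ((b ** Q ** N) $ j $ j) (1 :: 'n UA))
      = UA_scale (of_nat CARD('n) * trace (Q ** N ** b)) 1"
  proof -
    have "trace (Q ** N ** b) = (\<Sum>j\<in>UNIV. (b ** Q ** N) $ j $ j)"
      by (subst trace_mul_sym) (simp add: matrix_mul_assoc trace_def)
    then show ?thesis
      unfolding UA_vs.scale_sum_left[symmetric] by simp
  qed
  have "lower b (quad N) = (\<Sum>i\<in>UNIV. \<Sum>j\<in>UNIV. UA_gen (mscale ((b ** Q ** N) $ i $ j) (elem_mat i j))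
      + UA_gen (mscale ((b ** Q) $ j $ i) (N ** elem_mat j i)) - UA_scale ((b ** Q ** N) $ j $ j) 1)"
    unfolding quad_def lower_sum pair t1 t2 t3 ..
  then show ?thesis
    by (simp only: sum.distrib sum_subtractf s1 s2 s3)
qed

text \<open>This is the relation between \<open>\<B>\<close> and an arbitrary \<open>Y\<close>, evaluated at \<open>1\<close>; the formula for
  \<open>\<theta>\<close> is chosen to satisfy it.\<close>

lemma lower_\<theta>: "lower b (\<theta> Y) = - \<theta> (lie_bracket (block_mat 0 b 0 0) Y)"
proof -
  obtain a b' c d where Y: "Y = block_mat a b' c d"
    by (rule block_mat_cases)
  have tr: "trace (d ** Q ** b) = trace (Q ** b ** d)"
    by (metis matrix_mul_assoc trace_mul_sym)
  have cancel: "Q ** P ** X = X" "X ** Q ** P = X" "X ** P ** Q = X" for X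
    by (simp_all add: QP PQ flip: matrix_mul_assoc)
  have "lower b (\<theta> Y) = UA_scale (trace (Q ** a ** b)) 1
      - (UA_gen (b ** c) + UA_gen (P ** c ** b ** Q)) - UA_scale (trace (Q ** b ** d)) 1"
    by (simp add: Y \<theta>_def lower_add lower_diff lower_scale lower_UA_gen lower_one lower_quad
        matrix_mul_assoc cancel QP tr)
  also have "\<dots> = - \<theta> (lie_bracket (block_mat 0 b 0 0) Y)"
    by (simp add: Y \<theta>_def block_mat_lie_bracket lie_bracket_0 quad_def UA_gen_0 matrix_diff_ldistrib
        matrix_uminus_left matrix_uminus_right UA_gen_uminus matrix_mul_assoc trace_sub
        UA_vs.scale_left_diff_distrib)
  finally show ?thesis .
qed

lemma rel_B: "rel (block_mat 0 b 0 0) Y u = 0"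
proof (rule rel_eq_0_if_at_one[where S = "blockB" and T = UNIV])
  show "rel X Y 1 = 0" if "X \<in> blockB" "Y \<in> UNIV" for X Y
  proof -
    obtain b where X: "X = block_mat 0 b 0 0"
      using \<open>X \<in> blockB\<close> by (auto simp: blockB_eq)
    have "\<rho> X (\<theta> Y) = UA_scale (trace (Q ** b)) (\<theta> Y) + \<theta> (lie_bracket X Y)"
      using lower_\<theta>[of b Y] by (simp add: lower_def X algebra_simps)
    then show ?thesis
      by (simp add: rel_def \<rho>_one X \<rho>_B_one[unfolded \<rho>_one] \<rho>_scale)
  qed
qed (auto simp: blockB_eq block_mat_lie_bracket lie_bracket_0)

text \<open>As the relations with \<open>\<B>\<close> hold, \<open>\<B>\<close> commutes with the operator \<open>rel Y Z\<close> up to the defects of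
  brackets of \<open>\<B>\<close> with \<open>Y\<close> and \<open>Z\<close>. Such brackets lie closer to \<open>\<B>\<close>, so the relations
  can be proved in the order \<open>\<D>\<D>\<close>, \<open>\<C>\<D>\<close>, \<open>\<C>\<C>\<close>.\<close>

lemma lower_rel_one: "lower b (rel Y Z 1)
    = - rel (lie_bracket (block_mat 0 b 0 0) Y) Z 1 - rel Y (lie_bracket (block_mat 0 b 0 0) Z) 1"
proof -
  let ?b = "block_mat 0 b 0 0"
  have comm: "\<rho> ?b (\<rho> X u) = \<rho> X (\<rho> ?b u) + \<rho> (lie_bracket ?b X) u" for X u
    using rel_B[of b X u] by (simp add: rel_def algebra_simps)
  show ?thesis
    unfolding lower_def rel_def \<rho>_add \<rho>_diff comm \<rho>_B_one \<rho>_scale lie_bracket_jacobi[of ?b Y Z]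
    by (simp add: \<rho>_add \<rho>_add_left \<rho>_scale UA_vs.scale_right_distrib UA_vs.scale_right_diff_distrib)
qed

text \<open>If the defects on the right vanish, then \<open>rel Y Z 1\<close> is a scalar, and for \<open>Y\<close> and \<open>Z\<close>
  in \<open>\<C> \<oplus> \<D>\<close> it is zero: these elements map \<open>U(\<A>)\<close> into the augmentation ideal. This spares
  every computation with products of more than two generators.\<close>

lemma rel_CD_one:
  assumes Y: "Y = block_mat 0 0 c d" and Z: "Z = block_mat 0 0 c' d'"
    and lower: "\<And>b. lower b (rel Y Z 1) = 0"
  shows "rel Y Z 1 = 0"
proof -
  obtain \<epsilon> :: "'n UA \<Rightarrow> complex" where \<epsilon>:
    "\<epsilon> 1 = 1" "\<And>u v. \<epsilon> (u + v) = \<epsilon> u + \<epsilon> v" "\<And>c u. \<epsilon> (UA_scale c u) = c * \<epsilon> u"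
    "\<And>a u. \<epsilon> (UA_gen a * u) = 0"
    by (rule UA_counit) blast
  have \<epsilon>_0: "\<epsilon> 0 = 0"
    using \<epsilon>(2)[of 0 0] by simp
  have \<epsilon>_gen: "\<epsilon> (UA_gen a) = 0" for a
    using \<epsilon>(4)[of a 1] by simp
  have \<epsilon>_neg: "\<epsilon> (- u) = - \<epsilon> u" for u
    using \<epsilon>(2)[of u "- u"] by (simp add: \<epsilon>_0 eq_neg_iff_add_eq_0 add.commute)
  have \<epsilon>_diff: "\<epsilon> (u - v) = \<epsilon> u - \<epsilon> v" for u v
    using \<epsilon>(2)[of u "- v"] by (simp add: \<epsilon>_neg)
  have \<epsilon>_sum: "\<epsilon> (sum f I) = (\<Sum>i\<in>I. \<epsilon> (f i))" for f and I :: "'n set"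
    by (induction I rule: infinite_finite_induct) (simp_all add: \<epsilon> \<epsilon>_0)
  have \<epsilon>_\<rho>: "\<epsilon> (\<rho> (block_mat 0 0 c d) u) = 0" for c d u
  proof (induction u arbitrary: c d rule: UA_induct)
    case one
    show ?case
      by (simp add: \<rho>_one \<theta>_def quad_def UA_gen_0 \<epsilon> \<epsilon>_gen \<epsilon>_diff \<epsilon>_sum \<epsilon>_0 \<epsilon>_neg)
  qed (simp_all add: \<rho>_add \<rho>_scale \<rho>_gen \<epsilon> block_mat_lie_bracket lie_bracket_0)
  obtain r where r: "rel Y Z 1 = UA_scale r 1"
    using lower_eq_0_imp_scalar[OF lower] by blast
  have "\<epsilon> (rel Y Z 1) = 0"
    by (simp add: rel_def Y Z \<epsilon>(2) \<epsilon>_diff block_mat_lie_bracket lie_bracket_0 \<epsilon>_\<rho>)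
  then show ?thesis
    by (simp add: r \<epsilon>)
qed

lemma rel_DD: "rel (block_mat 0 0 0 d) (block_mat 0 0 0 d') u = 0"
proof (rule rel_eq_0_if_at_one[where S = blockD and T = blockD])
  show "rel X Y 1 = 0" if X: "X \<in> blockD" and Y: "Y \<in> blockD" for X Y
  proof -
    obtain d d' where XY: "X = block_mat 0 0 0 d" "Y = block_mat 0 0 0 d'"
      using X Y by (auto simp: blockD_eq)
    show ?thesis
      by (rule rel_CD_one[OF XY])
        (simp add: lower_rel_one XY block_mat_lie_bracket lie_bracket_0 rel_B rel_antisym[of _ "block_mat 0 _ 0 0"])
  qed
qed (auto simp: blockD_eq block_mat_lie_bracket lie_bracket_0)

lemma rel_AD_D: "rel (block_mat a 0 0 d) (block_mat 0 0 0 d') u = 0"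
proof -
  have "block_mat a 0 0 d = block_mat a 0 0 0 + block_mat 0 0 0 d"
    by (simp add: block_mat_add)
  then show ?thesis by (simp add: rel_add_left rel_A rel_DD)
qed

lemma rel_CD: "rel (block_mat 0 0 c 0) (block_mat 0 0 0 d) u = 0"
proof (rule rel_eq_0_if_at_one[where S = blockC and T = blockD])
  show "rel X Y 1 = 0" if X: "X \<in> blockC" and Y: "Y \<in> blockD" for X Y
  proof -
    obtain c d where XY: "X = block_mat 0 0 c 0" "Y = block_mat 0 0 0 d"
      using X Y by (auto simp: blockC_eq blockD_eq)
    show ?thesis
      by (rule rel_CD_one[OF XY])
        (simp add: lower_rel_one XY block_mat_lie_bracket lie_bracket_0 rel_AD_D rel_B rel_antisym[of _ "block_mat 0 _ 0 0"])
  qed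
qed (auto simp: blockC_eq blockD_eq block_mat_lie_bracket lie_bracket_0)

lemma rel_AD_C: "rel (block_mat a 0 0 d) (block_mat 0 0 c 0) u = 0"
proof -
  have "block_mat a 0 0 d = block_mat a 0 0 0 + block_mat 0 0 0 d"
    by (simp add: block_mat_add)
  moreover have "rel (block_mat 0 0 0 d) (block_mat 0 0 c 0) u = 0"
    unfolding rel_antisym[of "block_mat 0 0 0 d"] by (simp add: rel_CD)
  ultimately show ?thesis by (simp add: rel_add_left rel_A)
qed

lemma rel_CC: "rel (block_mat 0 0 c 0) (block_mat 0 0 c' 0) u = 0"
proof (rule rel_eq_0_if_at_one[where S = blockC and T = blockC])
  show "rel X Y 1 = 0" if X: "X \<in> blockC" and Y: "Y \<in> blockC" for X Y
  proof -
    obtain c c' where XY: "X = block_mat 0 0 c 0" "Y = block_mat 0 0 c' 0"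
      using X Y by (auto simp: blockC_eq)
    show ?thesis
      by (rule rel_CD_one[OF XY])
        (simp add: lower_rel_one XY block_mat_lie_bracket lie_bracket_0 rel_AD_C
          rel_antisym[of "block_mat 0 0 _ 0" "block_mat _ 0 0 _"])
  qed
qed (auto simp: blockC_eq block_mat_lie_bracket lie_bracket_0)

lemma rel_eq_0: "rel X Y u = 0"
proof -
  have split: "block_mat a b c d = block_mat a 0 0 0 + block_mat 0 b 0 0 + block_mat 0 0 c 0 + block_mat 0 0 0 d"
    for a b c d :: "complex^'n^'n"
    by (simp add: block_mat_add)
  have A: "rel Y (block_mat a 0 0 0) u = 0" for Y a
    using rel_antisym[of Y "block_mat a 0 0 0" u] by (simp add: rel_A)
  have B: "rel Y (block_mat 0 b 0 0) u = 0" for Y b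
    using rel_antisym[of Y "block_mat 0 b 0 0" u] by (simp add: rel_B)
  have DC: "rel (block_mat 0 0 0 d) (block_mat 0 0 c 0) u = 0" for c d
    using rel_antisym[of "block_mat 0 0 0 d" "block_mat 0 0 c 0" u] by (simp add: rel_CD)
  obtain a b c d a' b' c' d' where XY: "X = block_mat a b c d" "Y = block_mat a' b' c' d'"
    by (metis block_mat_cases)
  show ?thesis
    unfolding XY split[of a b c d] split[of a' b' c' d'] rel_add_left rel_add_right
    by (simp add: rel_A rel_B rel_CC rel_CD rel_DD A B DC)
qed

lemma \<rho>_lie_bracket: "\<rho> (lie_bracket X Y) u = \<rho> X (\<rho> Y u) - \<rho> Y (\<rho> X u)"
  using rel_eq_0[of X Y u] by (simp add: rel_def algebra_simps)

lemma gl_module_\<rho>: "gl_module UA_scale \<rho>"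
  unfolding gl_module_def using linear_\<rho> linear_\<rho>_left \<rho>_lie_bracket by blast

end

section \<open>Monomials in the matrix units\<close>

text \<open>The choice of one word for every multiset replaces an order on the matrix units.\<close>

definition UA_monomial :: "('n \<times> 'n) multiset \<Rightarrow> ('n::finite) UA" where
  "UA_monomial M = UA_word (map (\<lambda>p. elem_mat (fst p) (snd p)) (SOME xs. mset xs = M))"

lemma UA_monomial_cases:
  obtains xs where "mset xs = M" "UA_monomial M = UA_word (map (\<lambda>p. elem_mat (fst p) (snd p)) xs)"
  using someI_ex[OF ex_mset, of M] by (auto simp: UA_monomial_def)

lemma UA_monomial_empty: "UA_monomial {#} = 1"
  by (rule UA_monomial_cases[of "{#}"]) simp

lemma span_elem_mat: "mat_vs.span (range (\<lambda>p. elem_mat (fst p) (snd p))) = (UNIV :: (complex^'n::finite^'n) set)"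
proof -
  have "X \<in> mat_vs.span (range (\<lambda>p. elem_mat (fst p) (snd p)))" for X :: "complex^'n^'n"
  proof -
    have "elem_mat i j \<in> mat_vs.span (range (\<lambda>p. elem_mat (fst p) (snd p)))" for i j :: 'n
      by (rule mat_vs.span_base) (auto intro!: image_eqI[of _ _ "(i, j)"])
    then show ?thesis
      by (subst mat_eq_sum_elem_mat) (intro mat_vs.span_sum mat_vs.span_scale)
  qed
  then show ?thesis by blast
qed

lemma UA_below_eq_span_monomials:
  "UA_below k = UA_vs.span ((UA_monomial :: ('n \<times> 'n) multiset \<Rightarrow> ('n::finite) UA) ` {M. size M < k})"
proof -
  define nf where "nf M = map (\<lambda>p. elem_mat (fst p) (snd p)) (SOME xs. mset xs = M)" for M :: "('n \<times> 'n) multiset"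
  have mset_nf: "mset (nf M) = image_mset (\<lambda>p. elem_mat (fst p) (snd p)) M" for M
    using someI_ex[OF ex_mset, of M] by (simp add: nf_def)
  have "length (nf M) = size M" for M
    using arg_cong[OF mset_nf, of size M] by simp
  then have *: "{ys \<in> range nf. length ys < k} = nf ` {M. size M < k}"
    by auto
  have "\<exists>ys\<in>range nf. mset ys = mset xs" if xs: "set xs \<subseteq> range (\<lambda>p. elem_mat (fst p) (snd p))" for xs
  proof -
    obtain ps where "xs = map (\<lambda>p. elem_mat (fst p) (snd p)) ps"
    proof -
      have "xs \<in> lists (range (\<lambda>p. elem_mat (fst p) (snd p)))"
        using xs by (auto simp: in_lists_conv_set)
      then show thesis
        unfolding lists_image using that by auto
    qed
    then show ?thesis
      using mset_nf[of "mset ps"] by auto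
  qed
  from UA_below_eq_span_normal_words[OF span_elem_mat this, of k] show ?thesis
    unfolding * image_image by (simp add: UA_monomial_def nf_def)
qed

lemma finite_multisets_size_less: "finite {M :: 'a::finite multiset. size M < k}"
  and card_multisets_size_less: "card {M :: 'a::finite multiset. size M < k} \<le> k ^ CARD('a)"
proof -
  have sub: "count ` {M :: 'a multiset. size M < k} \<subseteq> PiE UNIV (\<lambda>_. {..<k})"
    using count_le_size le_less_trans by (fastforce simp: PiE_def)
  have inj: "inj_on count {M :: 'a multiset. size M < k}"
    by (simp add: inj_on_def multiset_eq_iff)
  have fin: "finite (PiE (UNIV :: 'a set) (\<lambda>_. {..<k}))"
    by (intro finite_PiE) auto
  show "finite {M :: 'a multiset. size M < k}"
    using finite_imageD[OF finite_subset[OF sub fin] inj] .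
  have "card {M :: 'a multiset. size M < k} = card (count ` {M :: 'a multiset. size M < k})"
    by (simp add: card_image inj)
  also have "\<dots> \<le> card (PiE (UNIV :: 'a set) (\<lambda>_. {..<k}))"
    by (intro card_mono fin sub)
  finally show "card {M :: 'a multiset. size M < k} \<le> k ^ CARD('a)"
    by (simp add: card_PiE)
qed

text \<open>Only the multisets with all multiplicities at most \<open>m\<close> are counted; this is enough for the order of
  growth.\<close>

lemma card_multisets_size_le: "(m + 1) ^ CARD('a) \<le> card {M :: 'a::finite multiset. size M < Suc (m * CARD('a))}"
proof -
  define f where "f g = (\<Sum>x\<in>UNIV. replicate_mset (g x) x)" for g :: "'a \<Rightarrow> nat"
  have count_f: "count (f g) x = g x" for g x
    by (simp add: f_def count_sum)
  have "size (f g) \<le> m * CARD('a)" if "\<And>x. g x \<le> m" for g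
    using sum_mono[of UNIV g "\<lambda>_. m"] that by (simp add: f_def size_multiset_sum mult.commute)
  then have "f ` PiE UNIV (\<lambda>_. {..m}) \<subseteq> {M. size M < Suc (m * CARD('a))}"
    by (auto simp: less_Suc_eq_le PiE_def Pi_def)
  moreover have "inj_on f (PiE UNIV (\<lambda>_. {..m}))"
    by (intro inj_onI ext) (metis count_f)
  ultimately have "card (PiE (UNIV :: 'a set) (\<lambda>_. {..m})) \<le> card {M :: 'a multiset. size M < Suc (m * CARD('a))}"
    using card_mono[OF finite_multisets_size_less] by (metis card_image)
  then show ?thesis
    by (simp add: card_PiE)
qed

lemma UA_gen_mult_below_pred: "u \<in> UA_below (k - 1) \<Longrightarrow> UA_gen a * u \<in> UA_below k"
  using UA_gen_mult_below[of u "k - 1" a] by (cases k) (auto simp: UA_below_zero)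

lemma subset_some_below:
  assumes "finite S"
  obtains k where "S \<subseteq> UA_below (Suc k)"
proof -
  have "\<exists>k. S \<subseteq> UA_below (Suc k)"
    using assms
  proof induction
    case (insert u S)
    then obtain j k where "u \<in> UA_below (Suc j)" "S \<subseteq> UA_below (Suc k)"
      using UA_in_some_below by metis
    then have "insert u S \<subseteq> UA_below (Suc (max j k))"
      using UA_below_mono[of "Suc j" "Suc (max j k)"] UA_below_mono[of "Suc k" "Suc (max j k)"] by auto
    then show ?case ..
  qed simp
  then show thesis using that by blast
qed

context whittaker_datum
begin

text \<open>On monomials, \<open>lower (elem_mat j i ** P)\<close> is the partial derivative with respect to the
  letter \<open>(i, j)\<close>, up to terms of smaller degree.\<close>

lemma lower_word: "lower (elem_mat (snd p) (fst p) ** P) (UA_word (map (\<lambda>p. elem_mat (fst p) (snd p)) xs))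
     - UA_scale (of_nat (count_list xs p)) (UA_word (map (\<lambda>p. elem_mat (fst p) (snd p)) (remove1 p xs)))
   \<in> UA_below (length xs - 1)"
proof (induction xs)
  case Nil
  show ?case by (simp add: lower_one UA_below_zero)
next
  case (Cons x xs)
  let ?E = "\<lambda>p. elem_mat (fst p) (snd p) :: complex^'n^'n"
  let ?b = "elem_mat (snd p) (fst p) ** P" and ?w = "UA_word (map ?E xs)"
    and ?w' = "UA_word (map ?E (remove1 p xs))" and ?c = "of_nat (count_list xs p) :: complex"
  have "trace (Q ** ?E x ** ?b) = trace (Q ** (?E x ** ?b))"
    by (simp add: matrix_mul_assoc)
  also have "\<dots> = trace (?E x ** elem_mat (snd p) (fst p) ** (P ** Q))"
    by (subst trace_mul_sym) (simp add: matrix_mul_assoc)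
  also have "\<dots> = (if x = p then 1 else 0)"
    unfolding PQ matrix_mul_rid trace_mult_elem_mat by (auto simp: elem_mat_def prod_eq_iff)
  finally have tr: "trace (Q ** ?E x ** ?b) = (if x = p then 1 else 0)" .
  have low: "lower (?E x ** ?b) ?w \<in> UA_below (length xs)"
    using lower_below[OF UA_word_in_below[of "map ?E xs" "Suc (length xs)"]] by simp
  have IH: "UA_gen (?E x) * (lower ?b ?w - UA_scale ?c ?w') \<in> UA_below (length xs)"
    by (rule UA_gen_mult_below_pred[OF Cons.IH])
  have eq: "lower ?b (UA_word (map ?E (x # xs))) = UA_gen (?E x) * (lower ?b ?w - UA_scale ?c ?w')
      + UA_scale ?c (UA_gen (?E x) * ?w') + UA_scale (if x = p then 1 else 0) ?w - lower (?E x ** ?b) ?w"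
    by (simp only: list.map UA_word_simps lower_gen tr) (simp add: algebra_simps UA_scale_mult_right)
  show ?case
  proof (cases "x = p")
    case False
    then show ?thesis
      using UA_below_diff[OF IH low] by (simp only: eq) (simp add: algebra_simps)
  next
    case True
    have perm: "UA_scale ?c (UA_gen (?E x) * ?w' - ?w) \<in> UA_below (length xs)"
    proof (cases "p \<in> set xs")
      case p: True
      have "mset (map ?E (p # remove1 p xs)) = mset (map ?E xs)"
      proof -
        have "mset (p # remove1 p xs) = mset xs"
          using p by simp
        then show ?thesis by (simp only: mset_map)
      qed
      moreover have "length (p # remove1 p xs) = length xs"
        using p length_pos_if_in_set[OF p] by (simp add: length_remove1)
      ultimately show ?thesis
        using UA_word_perm[of "map ?E (p # remove1 p xs)" "map ?E xs"] True
        by (intro UA_below_scale) simp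
    next
      case p: False
      then show ?thesis by (simp add: UA_below_zero)
    qed
    have "lower ?b (UA_word (map ?E (x # xs))) - UA_scale (of_nat (count_list (x # xs) p))
        (UA_word (map ?E (remove1 p (x # xs))))
      = UA_gen (?E x) * (lower ?b ?w - UA_scale ?c ?w') - lower (?E x ** ?b) ?w
        + UA_scale ?c (UA_gen (?E x) * ?w' - ?w)"
      unfolding eq by (simp add: True algebra_simps UA_vs.scale_left_distrib)
    also have "\<dots> \<in> UA_below (length xs)"
      by (intro UA_below_add UA_below_diff IH low perm)
    finally show ?thesis by simp
  qed
qed

lemma lower_monomial:
  "lower (elem_mat (snd p) (fst p) ** P) (UA_monomial M)
    - UA_scale (of_nat (count M p)) (UA_monomial (M - {#p#})) \<in> UA_below (size M - 1)"
proof -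
  let ?E = "\<lambda>p. elem_mat (fst p) (snd p) :: complex^'n^'n"
  obtain xs where xs: "mset xs = M" "UA_monomial M = UA_word (map ?E xs)"
    by (rule UA_monomial_cases)
  obtain ys where ys: "mset ys = M - {#p#}" "UA_monomial (M - {#p#}) = UA_word (map ?E ys)"
    by (rule UA_monomial_cases)
  have count: "count_list xs p = count M p" and size: "length xs = size M"
    using xs(1) by (auto simp flip: count_mset)
  have perm: "UA_scale (of_nat (count M p)) (UA_word (map ?E (remove1 p xs)) - UA_word (map ?E ys)) \<in> UA_below (size M - 1)"
  proof (cases "p \<in># M")
    case True
    then have "length (remove1 p xs) = size M - 1"
      using xs(1) by (auto simp: length_remove1)
    moreover have "mset (map ?E (remove1 p xs)) = mset (map ?E ys)"
      using xs(1) ys(1) by simp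
    ultimately show ?thesis
      using UA_word_perm[of "map ?E (remove1 p xs)" "map ?E ys"] by (auto intro!: UA_below_scale)
  next
    case False
    then show ?thesis by (simp add: not_in_iff UA_below_zero)
  qed
  from UA_below_add[OF lower_word[of p xs, unfolded count size] perm] show ?thesis
    by (simp add: xs ys UA_vs.scale_right_diff_distrib)
qed

text \<open>The derivative with respect to a letter \<open>p\<close> of \<open>M\<close> is injective on the monomials that contain
  \<open>p\<close> and kills the others, so it turns a relation in degree \<open>k + 1\<close> into one in degree \<open>k\<close> that still
  involves the coefficient of \<open>M\<close>, multiplied by a positive multiplicity.\<close>

lemma monomials_independent_mod_below:
  fixes S :: "('n \<times> 'n) multiset set"
  assumes "finite S" "\<And>M. M \<in> S \<Longrightarrow> size M = k"
    and "(\<Sum>M\<in>S. UA_scale (c M) (UA_monomial M)) \<in> UA_below k"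
    and "M \<in> S"
  shows "c M = 0"
  using assms
proof (induction k arbitrary: S c M)
  case 0
  then have "S = {{#}}" by auto
  then show ?case
    using 0 by (simp add: UA_monomial_empty)
next
  case (Suc k)
  obtain p where p: "p \<in># M"
    using Suc.prems(2)[OF Suc.prems(4)] by (metis size_eq_Suc_imp_elem)
  let ?low = "lower (elem_mat (snd p) (fst p) ** P)"
  define S' where "S' = (\<lambda>M. M - {#p#}) ` {M \<in> S. p \<in># M}"
  define c' where "c' N = c (add_mset p N) * of_nat (count (add_mset p N) p)" for N
  have inj: "inj_on (\<lambda>M. M - {#p#}) {M \<in> S. p \<in># M}"
    by (auto simp: inj_on_def) (metis insert_DiffM)
  have "(\<Sum>M\<in>S. UA_scale (c M) (UA_scale (of_nat (count M p)) (UA_monomial (M - {#p#}))))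
      = ?low (\<Sum>M\<in>S. UA_scale (c M) (UA_monomial M))
        - (\<Sum>M\<in>S. UA_scale (c M) (?low (UA_monomial M) - UA_scale (of_nat (count M p)) (UA_monomial (M - {#p#}))))"
    by (simp add: lower_sum lower_scale UA_vs.scale_right_diff_distrib sum_subtractf)
  also have "\<dots> \<in> UA_below k"
  proof (rule UA_below_diff)
    show "?low (\<Sum>M\<in>S. UA_scale (c M) (UA_monomial M)) \<in> UA_below k"
      using lower_below[OF Suc.prems(3)] by simp
    show "(\<Sum>M\<in>S. UA_scale (c M) (?low (UA_monomial M) - UA_scale (of_nat (count M p)) (UA_monomial (M - {#p#})))) \<in> UA_below k"
      using lower_monomial Suc.prems(2)
      by (intro UA_below_sum UA_below_scale) (metis diff_Suc_1)
  qed
  also have "(\<Sum>M\<in>S. UA_scale (c M) (UA_scale (of_nat (count M p)) (UA_monomial (M - {#p#}))))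
      = (\<Sum>M\<in>{M \<in> S. p \<in># M}. UA_scale (c M) (UA_scale (of_nat (count M p)) (UA_monomial (M - {#p#}))))"
    using Suc.prems(1) by (intro sum.mono_neutral_right) (auto simp: not_in_iff)
  also have "\<dots> = (\<Sum>N\<in>S'. UA_scale (c' N) (UA_monomial N))"
    unfolding S'_def by (subst sum.reindex[OF inj]) (auto intro!: sum.cong simp: c'_def)
  finally have "(\<Sum>N\<in>S'. UA_scale (c' N) (UA_monomial N)) \<in> UA_below k" .
  moreover have "finite S'" "M - {#p#} \<in> S'"
    using Suc.prems(1,4) p by (auto simp: S'_def)
  moreover have "size N = k" if "N \<in> S'" for N
    using that Suc.prems(2) by (auto simp: S'_def size_Diff_singleton)
  ultimately have "c' (M - {#p#}) = 0"
    by (intro Suc.IH)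
  then show ?case
    using p by (auto simp: c'_def count_eq_zero_iff)
qed

lemma monomials_independent:
  fixes S :: "('n \<times> 'n) multiset set"
  assumes "finite S" "(\<Sum>M\<in>S. UA_scale (c M) (UA_monomial M)) = 0" "M \<in> S"
  shows "c M = 0"
proof -
  have "c M = 0" if "\<And>M. M \<in> S \<Longrightarrow> size M < k" "finite S" "(\<Sum>M\<in>S. UA_scale (c M) (UA_monomial M)) = 0" "M \<in> S"
    for k and S :: "('n \<times> 'n) multiset set" and M
    using that
  proof (induction k arbitrary: S M)
    case (Suc k)
    let ?f = "\<lambda>M. UA_scale (c M) (UA_monomial M)"
    let ?S1 = "{M \<in> S. size M = k}" and ?S0 = "{M \<in> S. size M < k}"
    have S: "S = ?S0 \<union> ?S1"
      using Suc.prems(1) by (auto simp: less_Suc_eq)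
    have sum: "sum ?f S = sum ?f ?S0 + sum ?f ?S1"
    proof -
      have "sum ?f (?S0 \<union> ?S1) = sum ?f ?S0 + sum ?f ?S1"
        using Suc.prems(2) by (intro sum.union_disjoint) auto
      then show ?thesis by (simp only: S[symmetric])
    qed
    have "sum ?f ?S0 \<in> UA_below k"
      unfolding UA_below_eq_span_monomials
      by (intro UA_vs.span_sum UA_vs.span_scale UA_vs.span_base) auto
    moreover have "sum ?f ?S1 = - sum ?f ?S0"
      using sum Suc.prems(3) by (simp add: eq_neg_iff_add_eq_0 add.commute)
    ultimately have top: "sum ?f ?S1 \<in> UA_below k"
      by (simp only: UA_below_neg)
    have 1: "c M = 0" if "M \<in> ?S1" for M
    proof (rule monomials_independent_mod_below[OF _ _ top that])
      show "finite ?S1" using Suc.prems(2) by simp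
    qed simp
    then have "sum ?f ?S1 = 0"
      by (intro sum.neutral) auto
    then have zero: "sum ?f ?S0 = 0"
      using sum Suc.prems(3) by simp
    have "c M = 0" if "M \<in> ?S0" for M
    proof (rule Suc.IH[OF _ _ zero that])
      show "finite ?S0" using Suc.prems(2) by simp
    qed simp
    then show ?case
      using 1 S Suc.prems(4) by blast
  qed blast
  moreover have "size M < Suc (\<Sum>M\<in>S. size M)" if "M \<in> S" for M
    using member_le_sum[of M S size] assms(1) that by simp
  ultimately show ?thesis
    using assms by metis
qed

lemma dim_UA_below_upper:
  fixes V :: "'n UA set"
  shows "V \<subseteq> UA_below k \<Longrightarrow> UA_vs.dim V \<le> k ^ CARD('n \<times> 'n)"
proof -
  assume "V \<subseteq> UA_below k"
  then have "UA_vs.dim V \<le> card ((UA_monomial :: ('n \<times> 'n) multiset \<Rightarrow> _) ` {M. size M < k})"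
    by (intro UA_vs.dim_le_card finite_imageI finite_multisets_size_less)
      (simp add: UA_below_eq_span_monomials)
  also have "\<dots> \<le> card {M :: ('n \<times> 'n) multiset. size M < k}"
    by (intro card_image_le finite_multisets_size_less)
  also have "\<dots> \<le> k ^ CARD('n \<times> 'n)"
    by (rule card_multisets_size_less)
  finally show ?thesis .
qed

lemma dim_UA_below_lower:
  fixes V :: "'n UA set"
  assumes V: "UA_below (Suc (m * CARD('n \<times> 'n))) \<subseteq> V" "V \<subseteq> UA_below j"
  shows "(m + 1) ^ CARD('n \<times> 'n) \<le> UA_vs.dim V"
proof -
  let ?A = "{M :: ('n \<times> 'n) multiset. size M < Suc (m * CARD('n \<times> 'n))}"
  have inj: "inj_on UA_monomial ?A"
  proof (rule inj_onI, rule ccontr)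
    fix M N :: "('n \<times> 'n) multiset" assume "UA_monomial M = UA_monomial N" "M \<noteq> N"
    then show False
      using monomials_independent[of "{M, N}" "\<lambda>L. if L = M then 1 else - 1" M] by (simp split: if_splits)
  qed
  have indep: "UA_vs.independent (UA_monomial ` ?A)"
  proof
    assume "UA_vs.dependent (UA_monomial ` ?A)"
    then obtain T u v where T: "finite T" "T \<subseteq> UA_monomial ` ?A" "v \<in> T" "u v \<noteq> 0" "(\<Sum>v\<in>T. UA_scale (u v) v) = 0"
      unfolding UA_vs.dependent_explicit by blast
    then obtain S where S: "S \<subseteq> ?A" "finite S" "T = UA_monomial ` S"
      using finite_subset_image by meson
    have "(\<Sum>M\<in>S. UA_scale (u (UA_monomial M)) (UA_monomial M)) = 0"
      using T(5) S inj_on_subset[OF inj S(1)] by (simp add: sum.reindex)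
    then show False
      using monomials_independent[OF S(2), of "\<lambda>M. u (UA_monomial M)"] T S by auto
  qed
  obtain B where B: "B \<subseteq> V" "UA_vs.independent B" "V \<subseteq> UA_vs.span B" "card B = UA_vs.dim V"
    by (rule UA_vs.basis_exists)
  have "B \<subseteq> UA_vs.span (UA_monomial ` {M. size M < j})"
    using B(1) V(2) by (simp add: UA_below_eq_span_monomials)
  then have "finite B"
    using UA_vs.independent_span_bound[OF _ B(2)] finite_multisets_size_less by (metis finite_imageI)
  moreover have "UA_monomial ` ?A \<subseteq> UA_vs.span B"
  proof -
    have "UA_monomial ` ?A \<subseteq> UA_below (Suc (m * CARD('n \<times> 'n)))"
      unfolding UA_below_eq_span_monomials by (rule UA_vs.span_superset)
    then show ?thesis
      using V(1) B(3) by blast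
  qed
  ultimately have "card (UA_monomial ` ?A) \<le> card B"
    using UA_vs.independent_span_bound[OF _ indep] by blast
  moreover have "card (UA_monomial ` ?A) = card ?A"
    by (rule card_image[OF inj])
  ultimately show ?thesis
    using card_multisets_size_le[of m, where 'a = "'n \<times> 'n"] B(4) by linarith
qed


section \<open>Degrees, local finiteness and Gelfand-Kirillov dimension\<close>

text \<open>Compatibility with left multiplication propagates the degree of the values at \<open>1\<close>, for every
  set of matrices that is stable under brackets with \<open>\<A>\<close>.\<close>

lemma \<rho>_below:
  assumes S: "\<And>X a. X \<in> S \<Longrightarrow> lie_bracket X (block_mat a 0 0 0) \<in> S"
    and \<theta>: "\<And>X. X \<in> S \<Longrightarrow> \<theta> X \<in> UA_below (Suc d)"
    and "u \<in> UA_below k" "X \<in> S"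
  shows "\<rho> X u \<in> UA_below (k + d)"
  using assms(3,4)
proof (induction arbitrary: X rule: UA_below_induct)
  case (one k)
  then show ?case
    using \<theta>[of X] UA_below_mono[of "Suc d" "Suc k + d"] by (auto simp: \<rho>_one)
next
  case (gen k a u)
  have "UA_gen a * \<rho> X u \<in> UA_below (Suc k + d)"
    using UA_gen_mult_below[OF gen.IH[OF gen.prems], of a] by simp
  moreover have "\<rho> (lie_bracket X (block_mat a 0 0 0)) u \<in> UA_below (Suc k + d)"
    using gen.IH[OF S[OF gen.prems], of a] UA_below_mono[of "k + d" "Suc k + d"] by auto
  ultimately show ?case
    unfolding \<rho>_gen by (rule UA_below_add)
qed (auto simp: \<rho>_zero \<rho>_add \<rho>_scale intro: UA_below_zero UA_below_add UA_below_scale)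

lemma \<theta>_below: "\<theta> X \<in> UA_below (Suc 2)"
proof -
  have mono: "u \<in> UA_below (Suc 2)" if "u \<in> UA_below (Suc (Suc 0))" for u :: "'n UA"
    using that UA_below_mono[of "Suc (Suc 0)" "Suc 2"] by auto
  show ?thesis
    unfolding \<theta>_def quad_def numeral_2_eq_2
    by (intro UA_below_add UA_below_diff UA_below_scale UA_below_sum UA_gen_mult_below UA_gen_in_below
        one_in_UA_below)
qed

lemma \<rho>_below_2: "u \<in> UA_below k \<Longrightarrow> \<rho> X u \<in> UA_below (k + 2)"
  by (rule \<rho>_below[where S = UNIV, OF _ \<theta>_below]) simp_all

lemma \<rho>_A_below: "X \<in> blockA \<Longrightarrow> u \<in> UA_below k \<Longrightarrow> \<rho> X u \<in> UA_below (k + 1)"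
  by (auto simp: blockA_eq \<rho>_A UA_gen_mult_below)

lemma \<rho>_B_below:
  assumes "X \<in> blockB" "u \<in> UA_below k"
  shows "\<rho> X u \<in> UA_below k"
proof -
  have "\<theta> X \<in> UA_below (Suc 0)" if X: "X \<in> blockB" for X
  proof -
    obtain b where "X = block_mat 0 b 0 0"
      using X by (auto simp: blockB_eq)
    then have "\<theta> X = UA_scale (trace (Q ** b)) 1"
      using \<rho>_B_one by (simp add: \<rho>_one)
    then show ?thesis
      using UA_below_one by blast
  qed
  then have "\<rho> X u \<in> UA_below (k + 0)"
    using assms by (intro \<rho>_below[where S = blockB]) (auto simp: blockB_eq block_mat_lie_bracket lie_bracket_0)
  then show ?thesis by simp
qed

lemma \<rho>_D_below:
  assumes "X \<in> blockD" "u \<in> UA_below k"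
  shows "\<rho> X u \<in> UA_below (k + 1)"
proof (rule \<rho>_below[where S = blockD])
  show "\<theta> X \<in> UA_below (Suc 1)" if X: "X \<in> blockD" for X
  proof -
    obtain d where "X = block_mat 0 0 0 d"
      using X by (auto simp: blockD_eq)
    then have "\<theta> X = - UA_gen (P ** d ** Q)"
      by (simp add: \<theta>_def quad_def UA_gen_0)
    then show ?thesis
      using UA_below_neg[OF UA_gen_in_below] by simp
  qed
qed (use assms in \<open>auto simp: blockD_eq block_mat_lie_bracket lie_bracket_0\<close>)

lemma map_of_degree_\<rho>:
  assumes "ordered_basis blockA bs"
  shows "X \<in> blockA \<Longrightarrow> map_of_degree (PBW_filtration bs) 1 (\<rho> X)"
    and "X \<in> blockB \<Longrightarrow> map_of_degree (PBW_filtration bs) 0 (\<rho> X)"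
    and "map_of_degree (PBW_filtration bs) 2 (\<rho> X)"
    and "X \<in> blockD \<Longrightarrow> map_of_degree (PBW_filtration bs) 1 (\<rho> X)"
  using \<rho>_A_below[of X _ "Suc _"] \<rho>_B_below[of X _ "Suc _"] \<rho>_below_2[of _ "Suc _" X]
    \<rho>_D_below[of X _ "Suc _"]
  unfolding map_of_degree_def PBW_filtration_eq_UA_below[OF assms] image_subset_iff
  by simp_all

lemma locally_finite_\<rho>: "locally_finite_over blockB UA_scale \<rho>"
  unfolding locally_finite_over_def U_orbit_def
proof
  fix v :: "'n UA"
  obtain k where v: "v \<in> UA_below (Suc k)"
    by (rule UA_in_some_below)
  have "foldr \<rho> Xs v \<in> UA_below (Suc k)" if "set Xs \<subseteq> blockB" for Xs
    using that by (induction Xs) (auto intro!: \<rho>_B_below v)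
  then have "UA_vs.span {foldr \<rho> Xs v' |Xs v'. set Xs \<subseteq> blockB \<and> v' \<in> {v}} \<subseteq> UA_below (Suc k)"
    by (intro UA_vs.span_minimal subspace_UA_below) auto
  then show "\<exists>T. finite T \<and> UA_vs.span {foldr \<rho> Xs v' |Xs v'. set Xs \<subseteq> blockB \<and> v' \<in> {v}} \<subseteq> UA_vs.span T"
    unfolding UA_below_eq_span_monomials using finite_multisets_size_less by blast
qed

lemma U_orbit_upto_below:
  assumes "S \<subseteq> UA_below (Suc m)"
  shows "U_orbit_upto UA_scale \<rho> UNIV k S \<subseteq> UA_below (Suc m + 2 * k)"
  unfolding U_orbit_upto_def
proof (intro UA_vs.span_minimal subspace_UA_below subsetI)
  fix w assume "w \<in> {foldr \<rho> Xs v |Xs v. set Xs \<subseteq> UNIV \<and> length Xs \<le> k \<and> v \<in> S}"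
  then obtain Xs v where w: "w = foldr \<rho> Xs v" "length Xs \<le> k" "v \<in> S"
    by blast
  have "foldr \<rho> Xs v \<in> UA_below (Suc m + 2 * length Xs)" for Xs
  proof (induction Xs)
    case (Cons X Xs)
    then show ?case using \<rho>_below_2[OF Cons.IH, of X] by simp
  qed (use assms w(3) in auto)
  then show "w \<in> UA_below (Suc m + 2 * k)"
    using w UA_below_mono[of "Suc m + 2 * length Xs" "Suc m + 2 * k"] by auto
qed

lemma below_U_orbit_upto: "UA_below (Suc k) \<subseteq> U_orbit_upto UA_scale \<rho> UNIV k {1}"
proof -
  have "foldr \<rho> (map (\<lambda>a. block_mat a 0 0 0) xs) 1 = UA_word xs" for xs
    by (induction xs) (simp_all add: \<rho>_A)
  then show ?thesis
    unfolding UA_below_def U_orbit_upto_def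
    by (intro UA_vs.span_mono) (auto simp: less_Suc_eq_le, metis length_map)
qed

lemma log_power_growth:
  fixes a b :: real
  assumes "a > 0"
  shows "(\<lambda>k. ereal (log (real k) ((a * real k + b) ^ N))) \<longlonglongrightarrow> ereal (real N)"
proof -
  have "(\<lambda>k. real N * (ln (a * real k + b) / ln (real k))) \<longlonglongrightarrow> real N * 1"
    using assms by (intro tendsto_intros) real_asymp
  moreover have "eventually (\<lambda>k. real N * (ln (a * real k + b) / ln (real k)) = log (real k) ((a * real k + b) ^ N)) sequentially"
  proof -
    have "eventually (\<lambda>k. a * real k + b > 0) sequentially"
      using assms by real_asymp
    then show ?thesis
      by eventually_elim (simp add: log_def ln_realpow)
  qed
  ultimately show ?thesis
    by (simp add: tendsto_cong)
qed

text \<open>An element of \<open>gl\<close> raises the degree by at most \<open>2\<close>, so \<open>k\<close> of them lead from degree \<open>m\<close> to degree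
  at most \<open>m + 2 k\<close>. On the other hand, \<open>k\<close> elements of \<open>\<A>\<close> already produce all monomials of degree
  at most \<open>k\<close> from \<open>1\<close>. Both bounds grow like \<open>k\<close> to the power \<open>n\<^sup>2\<close>.\<close>

lemma GK_dimension_\<rho>: "GK_dimension UA_scale \<rho> = ereal (real (CARD('n) ^ 2))"
proof (rule antisym)
  let ?N = "CARD('n \<times> 'n)"
  have N: "real ?N = real (CARD('n) ^ 2)" and N_pos: "?N > 0"
    by (simp_all add: power2_eq_square)
  let ?g = "\<lambda>S k. ereal (log (real k) (real (UA_vs.dim (U_orbit_upto UA_scale \<rho> UNIV k S))))"
  show "GK_dimension UA_scale \<rho> \<le> ereal (real (CARD('n) ^ 2))"
    unfolding GK_dimension_def
  proof (rule SUP_least)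
    fix S :: "'n UA set" assume "S \<in> {S. finite S}"
    then obtain m where m: "S \<subseteq> UA_below (Suc m)"
      using subset_some_below by blast
    have "eventually (\<lambda>k. ?g S k \<le> ereal (log (real k) ((2 * real k + real (Suc m)) ^ ?N))) sequentially"
      using eventually_gt_at_top[of 1]
    proof eventually_elim
      case (elim k)
      let ?d = "UA_vs.dim (U_orbit_upto UA_scale \<rho> UNIV k S)"
      have "?d \<le> (Suc m + 2 * k) ^ ?N"
        by (intro dim_UA_below_upper U_orbit_upto_below m)
      then have "real ?d \<le> real ((Suc m + 2 * k) ^ ?N)"
        by (rule of_nat_mono)
      also have "\<dots> = (2 * real k + real (Suc m)) ^ ?N"
        by (simp only: of_nat_power of_nat_add of_nat_mult of_nat_numeral add.commute)
      finally have le: "real ?d \<le> (2 * real k + real (Suc m)) ^ ?N" .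
      \<comment> \<open>For dimension zero the logarithm is the default value \<open>log k 0 = 0\<close>.\<close>
      show ?case
      proof (cases "?d = 0")
        case True
        have "1 \<le> (2 * real k + real (Suc m)) ^ ?N"
          by (rule one_le_power) simp
        then have "0 \<le> log (real k) ((2 * real k + real (Suc m)) ^ ?N)"
          using elim by (subst zero_le_log_cancel_iff) linarith+
        moreover have "log (real k) (real ?d) = 0"
          using True by (simp add: log_def)
        ultimately show ?thesis
          by (simp only: ereal_less_eq)
      next
        case False
        with elim le show ?thesis by simp
      qed
    qed
    then have "limsup (?g S) \<le> limsup (\<lambda>k. ereal (log (real k) ((2 * real k + real (Suc m)) ^ ?N)))"
      by (rule Limsup_mono)
    also have "\<dots> = ereal (real ?N)"
      by (intro lim_imp_Limsup log_power_growth) simp_all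
    finally show "limsup (?g S) \<le> ereal (real (CARD('n) ^ 2))"
      by (simp only: N)
  qed
  have "ereal (real ?N) = limsup (\<lambda>k. ereal (log (real k) ((1 / real ?N * real k + 0) ^ ?N)))"
    using N_pos by (intro lim_imp_Limsup[symmetric] log_power_growth) simp_all
  also have "\<dots> \<le> limsup (?g {1})"
  proof (rule Limsup_mono)
    show "eventually (\<lambda>k. ereal (log (real k) ((1 / real ?N * real k + 0) ^ ?N)) \<le> ?g {1} k) sequentially"
      using eventually_gt_at_top[of 1]
    proof eventually_elim
      case (elim k)
      let ?d = "UA_vs.dim (U_orbit_upto UA_scale \<rho> UNIV k {1})"
      have "UA_below (Suc (k div ?N * ?N)) \<subseteq> UA_below (Suc k)"
        by (intro UA_below_mono) simp
      with below_U_orbit_upto[of k] have "(k div ?N + 1) ^ ?N \<le> ?d"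
        by (intro dim_UA_below_lower[OF _ U_orbit_upto_below[of _ 0]]) (auto simp: UA_below_one intro: exI[of _ 1])
      then have "real ((k div ?N + 1) ^ ?N) \<le> real ?d"
        by (rule of_nat_mono)
      moreover have "1 / real ?N * real k \<le> real (k div ?N + 1)"
      proof -
        have "k < ?N * (k div ?N + 1)"
          using N_pos dividend_less_times_div[of ?N k] by simp
        then have "real k \<le> real ?N * real (k div ?N + 1)"
          by (metis less_imp_le of_nat_le_iff of_nat_mult)
        then have "real k / real ?N \<le> real (k div ?N + 1)"
          using N_pos by (subst pos_divide_le_eq) (simp_all only: of_nat_0_less_iff mult.commute)
        then show ?thesis
          by (simp only: times_divide_eq_left mult_1_left)
      qed
      then have "(1 / real ?N * real k + 0) ^ ?N \<le> real (k div ?N + 1) ^ ?N"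
        by (intro power_mono) simp_all
      ultimately have "(1 / real ?N * real k + 0) ^ ?N \<le> real ?d"
        unfolding of_nat_power by linarith
      moreover have "0 < (1 / real ?N * real k + 0) ^ ?N"
        using elim N_pos by (intro zero_less_power) simp
      ultimately show ?case
        using elim unfolding ereal_less_eq by (intro log_mono) simp_all
    qed
  qed
  also have "\<dots> \<le> GK_dimension UA_scale \<rho>"
    unfolding GK_dimension_def by (rule SUP_upper) simp
  finally show "ereal (real (CARD('n) ^ 2)) \<le> GK_dimension UA_scale \<rho>"
    by (simp only: N)
qed

section \<open>Simplicity and the eigenvectors of \<open>\<B>\<close>\<close>

text \<open>A nonzero element of least degree in a submodule is annihilated by the lowering operators.\<close>

lemma simple_\<rho>: "simple_gl_module UA_scale \<rho>"
  unfolding simple_gl_module_def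
proof (intro conjI allI impI gl_module_\<rho>)
  show "\<exists>v :: 'n UA. v \<noteq> 0"
    using one_neq_zero by blast
  fix W :: "'n UA set"
  assume "UA_vs.subspace W \<and> (\<forall>X. \<rho> X ` W \<subseteq> W)"
  then have W: "UA_vs.subspace W" and \<rho>_W: "\<And>X v. v \<in> W \<Longrightarrow> \<rho> X v \<in> W"
    by auto
  show "W = {0} \<or> W = UNIV"
  proof (cases "W \<subseteq> {0}")
    case True
    then show ?thesis
      using UA_vs.subspace_0[OF W] by blast
  next
    case False
    then have "\<exists>k. \<exists>v\<in>W. v \<noteq> 0 \<and> v \<in> UA_below k"
      using UA_in_some_below by blast
    define k where "k = (LEAST k. \<exists>v\<in>W. v \<noteq> 0 \<and> v \<in> UA_below k)"
    have k: "\<exists>v\<in>W. v \<noteq> 0 \<and> v \<in> UA_below k"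
      unfolding k_def by (rule LeastI_ex) fact
    have min: "\<not> (\<exists>v\<in>W. v \<noteq> 0 \<and> v \<in> UA_below j)" if "j < k" for j
      using not_less_Least that unfolding k_def .
    from k obtain v where v: "v \<in> W" "v \<noteq> 0" "v \<in> UA_below k"
      by blast
    have "k > 0"
      using v by (cases k) auto
    have "lower b v = 0" for b
    proof -
      have "lower b v \<in> W"
        unfolding lower_def using v(1) \<rho>_W W by (intro UA_vs.subspace_diff UA_vs.subspace_scale)
      then show ?thesis
        using min[of "k - 1"] lower_below[OF v(3), of b] \<open>k > 0\<close> by auto
    qed
    then obtain c where c: "v = UA_scale c 1"
      using lower_eq_0_imp_scalar by blast
    with v(2) have "c \<noteq> 0" by auto
    then have "1 = UA_scale (inverse c) v"
      by (simp add: c)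
    then have "1 \<in> W"
      using UA_vs.subspace_scale[OF W v(1)] by metis
    have "u \<in> W" for u
    proof (induction u rule: UA_induct)
      case (gen a u)
      then show ?case using \<rho>_W[of u "block_mat a 0 0 0"] by (simp add: \<rho>_A)
    qed (auto intro: \<open>1 \<in> W\<close> UA_vs.subspace_add[OF W] UA_vs.subspace_scale[OF W])
    then show ?thesis by blast
  qed
qed

text \<open>On an eigenvector with another eigenvalue, \<open>lower b\<close> is a nonzero scalar, although it lowers the
  degree.\<close>

lemma eigenvector_B_character:
  assumes "v \<noteq> 0" "\<And>b. \<rho> (block_mat 0 b 0 0) v = UA_scale (h b) v"
  shows "h b = trace (Q ** b)"
proof (rule ccontr)
  assume "h b \<noteq> trace (Q ** b)"
  have low: "lower b v = UA_scale (trace (Q ** b) - h b) v"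
    by (simp add: lower_def assms(2) UA_vs.scale_left_diff_distrib)
  have v: "v = UA_scale (inverse (trace (Q ** b) - h b)) (lower b v)"
    using \<open>h b \<noteq> trace (Q ** b)\<close> by (simp add: low)
  have "v \<in> UA_below 0" if "v \<in> UA_below k" for k
    using that
  proof (induction k)
    case (Suc k)
    then have "lower b v \<in> UA_below k"
      using lower_below by fastforce
    then have "v \<in> UA_below k"
      by (subst v) (rule UA_below_scale)
    then show ?case by (rule Suc.IH)
  qed
  then show False
    using UA_in_some_below[of v] assms(1) by (metis UA_below_0 singletonD)
qed

end

text \<open>The parameter is read off from the common eigenvectors of \<open>\<B>\<close>.\<close>

lemma whittaker_datum_iso_imp_eq:
  assumes "whittaker_datum Q P" "whittaker_datum Q' P'"
    and iso: "module_iso_over UNIV UA_scale (whittaker_datum.\<rho> Q P) UA_scale (whittaker_datum.\<rho> Q' P') f"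
  shows "Q = Q'"
proof -
  interpret M: whittaker_datum Q P by fact
  interpret M': whittaker_datum Q' P' by fact
  interpret f: Vector_Spaces.linear UA_scale UA_scale f
    using iso by (simp add: module_iso_over_def)
  have f: "f (M.\<rho> X v) = M'.\<rho> X (f v)" for X v
    using iso by (simp add: module_iso_over_def)
  have "f 1 \<noteq> f 0"
    using iso by (metis bij_pointE module_iso_over_def zero_neq_one)
  then have "f 1 \<noteq> 0"
    by (simp add: f.zero)
  then have tr: "trace (Q ** b) = trace (Q' ** b)" for b
    by (rule M'.eigenvector_B_character) (simp add: M.\<rho>_B_one f.scale flip: f)
  have "Q $ j $ i = Q' $ j $ i" for i j
    using tr[of "elem_mat i j"] by (simp add: trace_mult_elem_mat)
  then show ?thesis
    by (simp add: vec_eq_iff)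
qed

lemma whittaker_datum_matrix_inv:
  assumes "invertible Q"
  shows "whittaker_datum Q (matrix_inv Q)"
proof
  have "\<exists>P. Q ** P = mat 1 \<and> P ** Q = mat 1"
    using assms by (simp add: invertible_def)
  from someI_ex[OF this, folded matrix_inv_def]
  show "Q ** matrix_inv Q = mat 1" "matrix_inv Q ** Q = mat 1"
    by blast+
qed

theorem theorem1:
  shows "\<exists>M :: complex^'n^'n \<Rightarrow> ('n::finite) gl2 \<Rightarrow> 'n UA \<Rightarrow> 'n UA.
    (\<forall>Q. invertible Q \<longrightarrow>
       simple_gl_module UA_scale (M Q) \<and>
       GK_dimension UA_scale (M Q) = ereal (real (CARD('n) ^ 2)) \<and>
       generalized_whittaker_module blockB UA_scale (M Q) \<and>
       (\<exists>\<phi>. module_iso_over blockA UA_scale (M Q) UA_scale left_regular \<phi> \<and>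
         (\<forall>bs. ordered_basis blockA bs \<longrightarrow>
            (\<forall>X\<in>blockA. map_of_degree (PBW_filtration bs) 1 (\<phi> \<circ> M Q X \<circ> inv \<phi>)) \<and>
            (\<forall>X\<in>blockB. map_of_degree (PBW_filtration bs) 0 (\<phi> \<circ> M Q X \<circ> inv \<phi>)) \<and>
            (\<forall>X\<in>blockC. map_of_degree (PBW_filtration bs) 2 (\<phi> \<circ> M Q X \<circ> inv \<phi>)) \<and>
            (\<forall>X\<in>blockD. map_of_degree (PBW_filtration bs) 1 (\<phi> \<circ> M Q X \<circ> inv \<phi>))))) \<and>
    (\<forall>Q Q'. invertible Q \<and> invertible Q' \<and> Q \<noteq> Q' \<longrightarrow>
       \<not> (\<exists>f. module_iso_over UNIV UA_scale (M Q) UA_scale (M Q') f))"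
proof (intro exI[of _ "\<lambda>Q. whittaker_datum.\<rho> Q (matrix_inv Q)"] conjI allI impI)
  fix Q :: "complex^'n^'n"
  assume "invertible Q"
  then interpret whittaker_datum Q "matrix_inv Q"
    by (rule whittaker_datum_matrix_inv)
  show "simple_gl_module UA_scale \<rho>"
    by (rule simple_\<rho>)
  show "GK_dimension UA_scale \<rho> = ereal (real (CARD('n) ^ 2))"
    by (rule GK_dimension_\<rho>)
  show "generalized_whittaker_module blockB UA_scale \<rho>"
    by (simp add: generalized_whittaker_module_def whittaker_pair_blockB gl_module_\<rho> locally_finite_\<rho>)
  show "\<exists>\<phi>. module_iso_over blockA UA_scale \<rho> UA_scale left_regular \<phi> \<and>
         (\<forall>bs. ordered_basis blockA bs \<longrightarrow>
            (\<forall>X\<in>blockA. map_of_degree (PBW_filtration bs) 1 (\<phi> \<circ> \<rho> X \<circ> inv \<phi>)) \<and>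
            (\<forall>X\<in>blockB. map_of_degree (PBW_filtration bs) 0 (\<phi> \<circ> \<rho> X \<circ> inv \<phi>)) \<and>
            (\<forall>X\<in>blockC. map_of_degree (PBW_filtration bs) 2 (\<phi> \<circ> \<rho> X \<circ> inv \<phi>)) \<and>
            (\<forall>X\<in>blockD. map_of_degree (PBW_filtration bs) 1 (\<phi> \<circ> \<rho> X \<circ> inv \<phi>)))"
  proof (rule exI[of _ id], intro conjI)
    show "module_iso_over blockA UA_scale \<rho> UA_scale left_regular id"
      using UA_vs.linear_id
      by (auto simp: module_iso_over_def blockA_eq \<rho>_A left_regular_def UA_gen_def)
  qed (simp add: map_of_degree_\<rho> del: One_nat_def)
next
  fix Q Q' :: "complex^'n^'n"
  assume "invertible Q \<and> invertible Q' \<and> Q \<noteq> Q'"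
  then show "\<not> (\<exists>f. module_iso_over UNIV UA_scale (whittaker_datum.\<rho> Q (matrix_inv Q)) UA_scale
      (whittaker_datum.\<rho> Q' (matrix_inv Q')) f)"
    using whittaker_datum_iso_imp_eq whittaker_datum_matrix_inv by blast
qed

end
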